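(* Let $n\in\mathbb N$ and let $B_1\in\mathcal S_n(\mathcal H_1)$, $B_2\in\mathcal S_n(\mathcal H_2)$ have Livsic characteristic functions $\Theta_1,\Theta_2$ (for some choice of representatives). If $\Theta_1$ is inner and $\Theta_1\le\Theta_2$, then $B_1\lesssim B_2$.
   Context: For a separable Hilbert space $\mathcal H$ and $n\in\mathbb N$, $\mathcal S_n(\mathcal H)$ is the set of linear transformations $B$ with domain $\mathrm{dom}(B)\subseteq\mathcal H$ (not necessarily dense) that are symmetric, closed, simple ($\bigcap_{z\in\mathbb C\setminus\mathbb R}\mathrm{ran}(B-z)=\{0\}$) and have deficiency indices $(n,n)$. For $z\in\mathbb C\setminus\mathbb R$ write $\ker(B^*-z):=\mathrm{ran}(B-\bar z)^\perp$, $b(z)=\frac{z-i}{z+i}$. The Livsic characteristic function is $\Theta_B(z)=b(z)B(z)^{-1}A(z)$ with $B(z)=[\langle w_j(z),u_k\rangle]$, $A(z)=[\langle w_j(z),v_k\rangle]$, $\{u_k\},\{v_k\}$ orthonormal bases of $\ker(B^*-i)$, $\ker(B^*+i)$, $\{w_j(z)\}$ a basis of $\ker(B^*-z)$, $z\in\mathbb C_+$; it is defined up to $\Theta\mapsto R\Theta Q$ with $R,Q$ constant unitary matrices. Inner means unitary nontangential boundary values a.e. on $\mathbb R$. For contractive analytic $n\times n$ functions with $\det\Theta\not\equiv0$, $\Theta\le\Phi$ means $\Theta^{-1}\Phi$ extends to a contractive analytic function on $\mathbb C_+$. $B_1\lesssim B_2$ means there is an isometry $W:\mathcal H_1\to\mathcal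 H_2$ with $W\mathrm{dom}(B_1)\subseteq\mathrm{dom}(B_2)$ and $B_2Wf=WB_1f$ for all $f\in\mathrm{dom}(B_1)$. *)

theory Defs
  imports "HOL-Analysis.Analysis"
begin

class complex_inner = real_normed_vector +
  fixes hscale :: "complex \<Rightarrow> 'a \<Rightarrow> 'a"
    and hinner :: "'a \<Rightarrow> 'a \<Rightarrow> complex"
  assumes hscale_add_right: "hscale a (x + y) = hscale a x + hscale a y"
    and hscale_add_left: "hscale (a + b) x = hscale a x + hscale b x"
    and hscale_hscale: "hscale a (hscale b x) = hscale (a * b) x"
    and hscale_one: "hscale 1 x = x"
    and hscale_of_real: "hscale (complex_of_real r) x = scaleR r x"
    and hinner_commute: "hinner x y = cnj (hinner y x)"
    and hinner_add_left: "hinner (x + y) z = hinner x z + hinner y z"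
    and hinner_hscale_left: "hinner (hscale c x) y = c * hinner x y"
    and hinner_self_nonneg: "0 \<le> Re (hinner x x)"
    and norm_eq_sqrt_hinner: "norm x = sqrt (Re (hinner x x))"

class chilbert = complex_inner + complete_space

instantiation complex :: chilbert
begin
definition hscale_complex :: "complex \<Rightarrow> complex \<Rightarrow> complex" where
  "hscale_complex a x = a * x"
definition hinner_complex :: "complex \<Rightarrow> complex \<Rightarrow> complex" where
  "hinner_complex x y = x * cnj y"
instance
proof
  fix x y z a b :: complex and r :: real
  show "hscale a (x + y) = hscale a x + hscale a y" by (simp add: hscale_complex_def algebra_simps)
  show "hscale (a + b) x = hscale a x + hscale b x" by (simp add: hscale_complex_def algebra_simps)
  show "hscale a (hscale b x) = hscale (a * b) x" by (simp add: hscale_complex_def)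
  show "hscale 1 x = x" by (simp add: hscale_complex_def)
  show "hscale (complex_of_real r) x = r *\<^sub>R x" by (simp add: hscale_complex_def scaleR_conv_of_real)
  show "hinner x y = cnj (hinner y x)" by (simp add: hinner_complex_def)
  show "hinner (x + y) z = hinner x z + hinner y z" by (simp add: hinner_complex_def algebra_simps)
  show "hinner (hscale a x) y = a * hinner x y" by (simp add: hinner_complex_def hscale_complex_def)
  show "0 \<le> Re (hinner x x)" by (simp add: hinner_complex_def)
  show "norm x = sqrt (Re (hinner x x))"
    by (simp add: hinner_complex_def complex_norm_square[symmetric])
qed
end

definition separable_hilbert :: "'a::chilbert itself \<Rightarrow> bool" where
  "separable_hilbert _ \<longleftrightarrow> (\<exists>C::'a set. countable C \<and> closure C = UNIV)"

text \<open>A linear transformation \<open>B\<close> with domain \<open>dom(B)\<close> is represented by a pair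
  \<open>(D, T)\<close>: a subspace \<open>D\<close> and a map \<open>T\<close> that is linear on \<open>D\<close> (values outside \<open>D\<close> are irrelevant).\<close>

definition csubspace :: "'a::complex_inner set \<Rightarrow> bool" where
  "csubspace S \<longleftrightarrow> 0 \<in> S \<and> (\<forall>x\<in>S. \<forall>y\<in>S. x + y \<in> S) \<and> (\<forall>c. \<forall>x\<in>S. hscale c x \<in> S)"

definition clinear_on :: "'a::complex_inner set \<Rightarrow> ('a \<Rightarrow> 'b::complex_inner) \<Rightarrow> bool" where
  "clinear_on D T \<longleftrightarrow> (\<forall>x\<in>D. \<forall>y\<in>D. T (x + y) = T x + T y) \<and>
      (\<forall>c. \<forall>x\<in>D. T (hscale c x) = hscale c (T x))"

definition lin_transf :: "'a::complex_inner set \<Rightarrow> ('a \<Rightarrow> 'a) \<Rightarrow> bool" where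
  "lin_transf D T \<longleftrightarrow> csubspace D \<and> clinear_on D T"

definition symmetric_op :: "'a::complex_inner set \<Rightarrow> ('a \<Rightarrow> 'a) \<Rightarrow> bool" where
  "symmetric_op D T \<longleftrightarrow> (\<forall>f\<in>D. \<forall>g\<in>D. hinner (T f) g = hinner f (T g))"

definition closed_op :: "'a::complex_inner set \<Rightarrow> ('a \<Rightarrow> 'a) \<Rightarrow> bool" where
  "closed_op D T \<longleftrightarrow> closed {(f, T f) | f. f \<in> D}"

definition ran_shift :: "'a::complex_inner set \<Rightarrow> ('a \<Rightarrow> 'a) \<Rightarrow> complex \<Rightarrow> 'a set" where
  "ran_shift D T z = {T f - hscale z f | f. f \<in> D}"

definition simple_op :: "'a::complex_inner set \<Rightarrow> ('a \<Rightarrow> 'a) \<Rightarrow> bool" where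
  "simple_op D T \<longleftrightarrow> (\<Inter>{ran_shift D T z | z. Im z \<noteq> 0}) = {0}"

definition orth_compl :: "'a::complex_inner set \<Rightarrow> 'a set" where
  "orth_compl S = {x. \<forall>y\<in>S. hinner x y = 0}"

text \<open>\<open>ker(B^* - z) := ran(B - conj z)^\<bottom>\<close>\<close>
definition defect :: "'a::complex_inner set \<Rightarrow> ('a \<Rightarrow> 'a) \<Rightarrow> complex \<Rightarrow> 'a set" where
  "defect D T z = orth_compl (ran_shift D T (cnj z))"

definition has_dim :: "'a::complex_inner set \<Rightarrow> nat \<Rightarrow> bool" where
  "has_dim V n \<longleftrightarrow> (\<exists>e::nat \<Rightarrow> 'a.
      V = {\<Sum>i<n. hscale (c i) (e i) | c. True} \<and>
      (\<forall>c. (\<Sum>i<n. hscale (c i) (e i)) = 0 \<longrightarrow> (\<forall>i<n. c i = 0)))"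

definition in_S :: "nat \<Rightarrow> 'a::chilbert set \<Rightarrow> ('a \<Rightarrow> 'a) \<Rightarrow> bool" where
  "in_S n D T \<longleftrightarrow> lin_transf D T \<and> symmetric_op D T \<and> closed_op D T \<and> simple_op D T \<and>
      has_dim (defect D T \<i>) n \<and> has_dim (defect D T (- \<i>)) n"

definition is_basis_fam :: "('n::finite \<Rightarrow> 'a::complex_inner) \<Rightarrow> 'a set \<Rightarrow> bool" where
  "is_basis_fam e V \<longleftrightarrow> V = {\<Sum>i\<in>UNIV. hscale (c i) (e i) | c. True} \<and>
      (\<forall>c. (\<Sum>i\<in>UNIV. hscale (c i) (e i)) = 0 \<longrightarrow> (\<forall>i. c i = 0))"

definition is_onb_fam :: "('n::finite \<Rightarrow> 'a::complex_inner) \<Rightarrow> 'a set \<Rightarrow> bool" where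
  "is_onb_fam e V \<longleftrightarrow> is_basis_fam e V \<and> (\<forall>i j. hinner (e i) (e j) = (if i = j then 1 else 0))"

definition bfac :: "complex \<Rightarrow> complex" where
  "bfac z = (z - \<i>) / (z + \<i>)"

definition upper_half :: "complex set" where
  "upper_half = {z. 0 < Im z}"

text \<open>\<open>\<Theta>\<close> is (a representative of) the Livsic characteristic function of \<open>B = (D,T)\<close>;
  only its values on the upper half-plane matter.\<close>
definition livsic_cf :: "'a::chilbert set \<Rightarrow> ('a \<Rightarrow> 'a) \<Rightarrow> (complex \<Rightarrow> complex^'n::finite^'n) \<Rightarrow> bool" where
  "livsic_cf D T \<Theta> \<longleftrightarrow> (\<exists>(u::'n \<Rightarrow> 'a) (v::'n \<Rightarrow> 'a) (w::complex \<Rightarrow> 'n \<Rightarrow> 'a).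
      is_onb_fam u (defect D T \<i>) \<and> is_onb_fam v (defect D T (- \<i>)) \<and>
      (\<forall>z\<in>upper_half. is_basis_fam (w z) (defect D T z) \<and>
         (let Bm = (\<chi> j k. hinner (w z j) (u k)); Am = (\<chi> j k. hinner (w z j) (v k))
          in \<Theta> z = (\<chi> j k. bfac z * (matrix_inv Bm ** Am) $ j $ k))))"

definition contractive_analytic :: "(complex \<Rightarrow> complex^'n::finite^'n) \<Rightarrow> bool" where
  "contractive_analytic \<Theta> \<longleftrightarrow> (\<forall>i j. (\<lambda>z. \<Theta> z $ i $ j) holomorphic_on upper_half) \<and>
      (\<forall>z\<in>upper_half. \<forall>x. norm (\<Theta> z *v x) \<le> norm x)"

definition cadj :: "complex^'n::finite^'n \<Rightarrow> complex^'n^'n" where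
  "cadj M = (\<chi> i j. cnj (M $ j $ i))"

definition unitary_mat :: "complex^'n::finite^'n \<Rightarrow> bool" where
  "unitary_mat U \<longleftrightarrow> U ** cadj U = mat 1 \<and> cadj U ** U = mat 1"

definition stolz :: "real \<Rightarrow> real \<Rightarrow> complex set" where
  "stolz x c = {z. 0 < Im z \<and> \<bar>Re z - x\<bar> \<le> c * Im z}"

definition inner_fn :: "(complex \<Rightarrow> complex^'n::finite^'n) \<Rightarrow> bool" where
  "inner_fn \<Theta> \<longleftrightarrow> contractive_analytic \<Theta> \<and>
      (AE x in lborel. \<exists>U. unitary_mat U \<and>
          (\<forall>c>0. (\<Theta> \<longlongrightarrow> U) (at (complex_of_real x) within stolz x c)))"

definition cf_le :: "(complex \<Rightarrow> complex^'n::finite^'n) \<Rightarrow> (complex \<Rightarrow> complex^'n^'n) \<Rightarrow> bool" where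
  "cf_le \<Theta> \<Phi> \<longleftrightarrow> contractive_analytic \<Theta> \<and> contractive_analytic \<Phi> \<and>
      (\<exists>z\<in>upper_half. det (\<Theta> z) \<noteq> 0) \<and>
      (\<exists>G. contractive_analytic G \<and>
         (\<forall>z\<in>upper_half. det (\<Theta> z) \<noteq> 0 \<longrightarrow> G z = matrix_inv (\<Theta> z) ** \<Phi> z))"

definition isometry :: "('a::complex_inner \<Rightarrow> 'b::complex_inner) \<Rightarrow> bool" where
  "isometry W \<longleftrightarrow> clinear_on UNIV W \<and> (\<forall>x. norm (W x) = norm x)"

definition op_le :: "'a::chilbert set \<Rightarrow> ('a \<Rightarrow> 'a) \<Rightarrow> 'b::chilbert set \<Rightarrow> ('b \<Rightarrow> 'b) \<Rightarrow> bool" where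
  "op_le D1 T1 D2 T2 \<longleftrightarrow> (\<exists>W::'a \<Rightarrow> 'b. isometry W \<and> W ` D1 \<subseteq> D2 \<and>
      (\<forall>f\<in>D1. T2 (W f) = W (T1 f)))"

end

theory Submission
  imports Defs "HOL-Complex_Analysis.Complex_Analysis"
begin

text \<open>
Let \<open>V\<close> be the Cayley transform of \<open>B\<close>, extended by \<open>0\<close> to \<open>ker(B\<^sup>* - i)\<close>.  In the disc variable \<open>\<zeta> = b(z)\<close> the
characteristic function is \<open>\<Sum>\<^sub>t \<zeta>\<^sup>t\<^sup>+\<^sup>1 \<langle>V\<^sup>*\<^sup>t u\<^sub>j, v\<^sub>k\<rangle>\<close>, the transfer function of the conservative system
\<open>x' = V\<^sup>* x + \<Sum>\<^sub>j d\<^sub>j u\<^sub>j\<close>, \<open>y\<^sub>k = \<langle>x, v\<^sub>k\<rangle>\<close>.  Its energy balance expresses \<open>\<parallel>x\<parallel>\<^sup>2\<close> as input minus output energy, so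
\<open>\<Theta>\<^sub>2 = \<Theta>\<^sub>1 G\<close> with \<open>G\<close> contractive makes \<open>V\<^sub>2\<^sup>*\<^sup>t u\<^sub>2\<^sub>j \<mapsto> V\<^sub>1\<^sup>*\<^sup>t u\<^sub>1\<^sub>j\<close> a contraction; let \<open>W\<close> be its adjoint.  If \<open>\<Theta>\<^sub>1\<close> is
inner, Parseval gives \<open>V\<^sub>1\<^sup>m v\<^sub>k \<longrightarrow> 0\<close>, and simplicity of \<open>B\<^sub>1\<close> extends this to \<open>V\<^sub>1\<^sup>m h \<longrightarrow> 0\<close> for all \<open>h\<close>, i.e.
\<open>\<parallel>h\<parallel>\<^sup>2 = \<Sum> \<bar>\<langle>h, V\<^sub>1\<^sup>*\<^sup>t u\<^sub>1\<^sub>j\<rangle>\<bar>\<^sup>2 \<le> \<parallel>W h\<parallel>\<^sup>2\<close>.  Hence \<open>W\<close> is an isometry, and comparison of norms shows that it intertwines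
\<open>V\<^sub>1\<close> and \<open>V\<^sub>2\<close> off \<open>ker(B\<^sub>1\<^sup>* - i)\<close>.
\<close>

section \<open>Complex inner product spaces\<close>

lemma hinner_add_right: "hinner x (y + z) = hinner x y + hinner x (z::'a::complex_inner)"
  by (metis complex_cnj_add hinner_add_left hinner_commute)

lemma hinner_hscale_right: "hinner x (hscale c y) = cnj c * hinner x (y::'a::complex_inner)"
  by (metis complex_cnj_mult hinner_commute hinner_hscale_left)

lemma hscale_zero_left [simp]: "hscale 0 (x::'a::complex_inner) = 0"
  using hscale_of_real[of 0 x] by simp

lemma hscale_minus_one: "hscale (- 1) (x::'a::complex_inner) = - x"
  using hscale_of_real[of "-1" x] by simp

lemma hscale_zero_right [simp]: "hscale c (0::'a::complex_inner) = 0"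
  using hscale_add_right[of c 0 0] by simp

lemma hscale_minus_right [simp]: "hscale c (- x::'a::complex_inner) = - hscale c x"
  using hscale_add_right[of c x "-x"] by (simp add: eq_neg_iff_add_eq_0 add.commute)

lemma hscale_minus_left [simp]: "hscale (- c) (x::'a::complex_inner) = - hscale c x"
  using hscale_add_left[of c "-c" x] by (simp add: eq_neg_iff_add_eq_0 add.commute)

lemma hscale_diff_right: "hscale c (x - y::'a::complex_inner) = hscale c x - hscale c y"
  using hscale_add_right[of c x "-y"] by simp

lemma hscale_diff_left: "hscale (a - b) (x::'a::complex_inner) = hscale a x - hscale b x"
  using hscale_add_left[of a "-b" x] by simp

lemma hinner_zero_left [simp]: "hinner 0 (x::'a::complex_inner) = 0"
  using hinner_add_left[of 0 0 x] by simp

lemma hinner_zero_right [simp]: "hinner (x::'a::complex_inner) 0 = 0"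
  using hinner_add_right[of x 0 0] by simp

lemma hinner_minus_left [simp]: "hinner (- x) (y::'a::complex_inner) = - hinner x y"
  using hinner_add_left[of x "-x" y] by (simp add: eq_neg_iff_add_eq_0 add.commute)

lemma hinner_minus_right [simp]: "hinner x (- y::'a::complex_inner) = - hinner x y"
  using hinner_add_right[of x y "-y"] by (simp add: eq_neg_iff_add_eq_0 add.commute)

lemma hinner_diff_left: "hinner (x - y) (z::'a::complex_inner) = hinner x z - hinner y z"
  using hinner_add_left[of x "-y" z] by simp

lemma hinner_diff_right: "hinner x (y - z::'a::complex_inner) = hinner x y - hinner x z"
  using hinner_add_right[of x y "-z"] by simp

lemma hinner_sum_left: "hinner (sum f A) (y::'a::complex_inner) = (\<Sum>i\<in>A. hinner (f i) y)"
  by (induction A rule: infinite_finite_induct) (auto simp: hinner_add_left)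

lemma hinner_sum_right: "hinner (y::'a::complex_inner) (sum f A) = (\<Sum>i\<in>A. hinner y (f i))"
  by (induction A rule: infinite_finite_induct) (auto simp: hinner_add_right)

lemma hscale_sum_right: "hscale c (sum f A :: 'a::complex_inner) = (\<Sum>i\<in>A. hscale c (f i))"
  by (induction A rule: infinite_finite_induct) (auto simp: hscale_add_right)

lemmas hinner_simps = hinner_add_left hinner_add_right hinner_diff_left hinner_diff_right
  hinner_hscale_left hinner_hscale_right hinner_sum_left hinner_sum_right

lemma hinner_self: "hinner x (x::'a::complex_inner) = of_real ((norm x)\<^sup>2)"
proof -
  have "Im (hinner x x) = 0"
    using arg_cong[OF hinner_commute[of x x], of Im] by simp
  then show ?thesis
    by (simp add: complex_eq_iff norm_eq_sqrt_hinner hinner_self_nonneg)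
qed

lemma hinner_self_eq_0 [simp]: "hinner x (x::'a::complex_inner) = 0 \<longleftrightarrow> x = 0"
  by (simp add: hinner_self)

lemma norm_hscale: "norm (hscale c (x::'a::complex_inner)) = cmod c * norm x"
proof -
  have "hinner (hscale c x) (hscale c x) = of_real ((cmod c * norm x)\<^sup>2)"
    by (simp add: hinner_hscale_left hinner_hscale_right hinner_self[of x] power_mult_distrib complex_norm_square
        mult_ac del: of_real_power)
  then have "(norm (hscale c x))\<^sup>2 = (cmod c * norm x)\<^sup>2"
    by (metis hinner_self of_real_eq_iff)
  then show ?thesis by (simp add: power2_eq_iff_nonneg)
qed

lemma norm_add_sq: "(norm (x + y::'a::complex_inner))\<^sup>2 = (norm x)\<^sup>2 + (norm y)\<^sup>2 + 2 * Re (hinner x y)"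
proof -
  have "Re (hinner (x + y) (x + y)) = Re (hinner x x) + Re (hinner y y) + Re (hinner x y) + Re (hinner y x)"
    by (simp add: hinner_simps)
  moreover have "Re (hinner y x) = Re (hinner x y)"
    by (subst hinner_commute) simp
  ultimately show ?thesis by (simp add: hinner_self)
qed

lemma norm_diff_sq: "(norm (x - y::'a::complex_inner))\<^sup>2 = (norm x)\<^sup>2 + (norm y)\<^sup>2 - 2 * Re (hinner x y)"
  using norm_add_sq[of x "-y"] by simp

lemma norm_hinner_le: "cmod (hinner x y) \<le> norm x * norm (y::'a::complex_inner)"
proof (cases "y = 0")
  case False
  define c where "c = hinner x y / of_real ((norm y)\<^sup>2)"
  have ny: "(norm y)\<^sup>2 > 0" using False by simp
  have "hinner (x - hscale c y) (x - hscale c y)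
     = hinner x x - cnj c * hinner x y - c * hinner y x + c * cnj c * hinner y y"
    by (simp add: hinner_simps algebra_simps)
  also have "c * hinner y y = hinner x y"
    using False by (simp add: c_def hinner_self)
  then have "c * cnj c * hinner y y = cnj c * hinner x y"
    by (metis mult.commute mult.left_commute)
  also have "c * hinner y x = cnj c * hinner x y"
    by (simp add: c_def hinner_commute[of y x])
  finally have "of_real ((norm (x - hscale c y))\<^sup>2) = of_real ((norm x)\<^sup>2) - cnj c * hinner x y"
    by (simp add: hinner_self)
  also have "cnj c * hinner x y = of_real ((cmod (hinner x y))\<^sup>2 / (norm y)\<^sup>2)"
    by (simp add: c_def complex_norm_square mult_ac del: of_real_power) 
  finally have "(norm (x - hscale c y))\<^sup>2 = (norm x)\<^sup>2 - (cmod (hinner x y))\<^sup>2 / (norm y)\<^sup>2"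
    by (metis of_real_diff of_real_eq_iff)
  then have "(cmod (hinner x y))\<^sup>2 / (norm y)\<^sup>2 \<le> (norm x)\<^sup>2"
    by (smt (verit) zero_le_power2)
  then have "(cmod (hinner x y))\<^sup>2 \<le> (norm x * norm y)\<^sup>2"
    using ny by (simp add: divide_simps power_mult_distrib)
  then show ?thesis by (rule power2_le_imp_le) simp
qed simp

lemma bounded_bilinear_hinner: "bounded_bilinear (hinner :: 'a::complex_inner \<Rightarrow> 'a \<Rightarrow> complex)"
proof
  fix a b :: 'a and r :: real
  show "hinner (r *\<^sub>R a) b = r *\<^sub>R hinner a b"
    by (metis hinner_hscale_left hscale_of_real scaleR_conv_of_real)
  show "hinner a (r *\<^sub>R b) = r *\<^sub>R hinner a b"
    by (metis complex_cnj_complex_of_real hinner_hscale_right hscale_of_real scaleR_conv_of_real)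
  show "\<exists>K. \<forall>(a::'a) b. cmod (hinner a b) \<le> norm a * norm b * K"
    by (rule exI[of _ 1]) (simp add: norm_hinner_le)
qed (simp_all add: hinner_simps)

lemma bounded_bilinear_hscale: "bounded_bilinear (hscale :: complex \<Rightarrow> 'a::complex_inner \<Rightarrow> 'a)"
proof
  fix a :: complex and b :: 'a and r :: real
  show "hscale (r *\<^sub>R a) b = r *\<^sub>R hscale a b"
    by (metis hscale_hscale hscale_of_real scaleR_conv_of_real)
  show "hscale a (r *\<^sub>R b) = r *\<^sub>R hscale a b"
    by (metis hscale_hscale hscale_of_real mult.commute)
  show "\<exists>K. \<forall>a (b::'a). norm (hscale a b) \<le> norm a * norm b * K"
    by (rule exI[of _ 1]) (simp add: norm_hscale)
qed (simp_all add: hscale_add_left hscale_add_right)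

lemmas tendsto_hinner = bounded_bilinear.tendsto[OF bounded_bilinear_hinner]
lemmas tendsto_hscale = bounded_bilinear.tendsto[OF bounded_bilinear_hscale]
lemmas continuous_on_hinner = bounded_bilinear.continuous_on[OF bounded_bilinear_hinner]

section \<open>Subspaces, Riesz representation and orthogonal projection\<close>

lemma csubspaceD:
  assumes "csubspace S"
  shows "0 \<in> S" "x \<in> S \<Longrightarrow> y \<in> S \<Longrightarrow> x + y \<in> S" "x \<in> S \<Longrightarrow> hscale c x \<in> S"
    "x \<in> S \<Longrightarrow> y \<in> S \<Longrightarrow> x - y \<in> S" "x \<in> S \<Longrightarrow> - x \<in> S"
proof -
  show 1: "0 \<in> S" "x \<in> S \<Longrightarrow> y \<in> S \<Longrightarrow> x + y \<in> S" "x \<in> S \<Longrightarrow> hscale c x \<in> S" for x y c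
    using assms by (auto simp: csubspace_def)
  show 2: "x \<in> S \<Longrightarrow> - x \<in> S" for x
    by (metis 1(3) hscale_minus_one)
  show "x \<in> S \<Longrightarrow> y \<in> S \<Longrightarrow> x - y \<in> S"
    by (metis 1(2) 2 diff_conv_add_uminus)
qed

text \<open>The minimizing sequence of \<open>k \<mapsto> \<parallel>k\<parallel>\<^sup>2 - 2 Re \<phi> k\<close> is Cauchy by the parallelogram law.  The functional
  is given by its graph, so that well-definedness follows from the bound and need not be checked.\<close>

lemma riesz_closure:
  fixes R :: "('a::chilbert \<times> complex) set"
  assumes zero: "(0, 0) \<in> R"
    and add: "\<And>k c k' c'. (k, c) \<in> R \<Longrightarrow> (k', c') \<in> R \<Longrightarrow> (k + k', c + c') \<in> R"
    and scale: "\<And>k c a. (k, c) \<in> R \<Longrightarrow> (hscale a k, a * c) \<in> R"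
    and bound: "\<And>k c. (k, c) \<in> R \<Longrightarrow> cmod c \<le> C * norm k"
  shows "\<exists>p\<in>closure (fst ` R). \<forall>(k, c)\<in>R. hinner k p = c"
proof -
  define J where "J = (\<lambda>(k::'a, c::complex). (norm k)\<^sup>2 - 2 * Re c)"
  have low: "- (C\<^sup>2) \<le> J q" if "q \<in> R" for q
  proof -
    obtain k c where q: "q = (k, c)" by (cases q)
    have "Re c \<le> C * norm k"
      using bound[OF that[unfolded q]] complex_Re_le_cmod[of c] by linarith
    \<comment> \<open>Completing the square turns \<open>Re c <= C * norm k\<close> into
      \<open>J >= - C^2\<close>.\<close>
    moreover have "0 \<le> (norm k - C)\<^sup>2" by simp
    ultimately show ?thesis
      by (simp add: J_def q power2_eq_square algebra_simps)
  qed
  define m where "m = Inf (J ` R)"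
  have ne: "J ` R \<noteq> {}" using zero by auto
  have bdd: "bdd_below (J ` R)" using low by (intro bdd_belowI) auto
  have mle: "m \<le> J q" if "q \<in> R" for q
    unfolding m_def using bdd that by (simp add: cInf_lower)
  have "\<exists>q\<in>R. J q < m + inverse (real (Suc i))" for i
    using cInf_less_iff[OF ne bdd, of "m + inverse (real (Suc i))"]
    unfolding m_def[symmetric] by simp
  then obtain q where q: "\<And>i. q i \<in> R" "\<And>i. J (q i) < m + inverse (real (Suc i))"
    by metis
  define k where "k i = fst (q i)" for i
  have kq: "(k i, snd (q i)) \<in> R" for i using q by (simp add: k_def)
  have para: "(norm (k i - k j))\<^sup>2 \<le> 2 * inverse (real (Suc i)) + 2 * inverse (real (Suc j))" for i j
  proof -
    \<comment> \<open>The midpoint of two near-minimizers still lies in \<open>R\<close>, so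
      \<open>J\<close> is at least \<open>m\<close> there; with the parallelogram law this bounds
      their distance.\<close>
    let ?h = "(hscale (1/2) (k i + k j), 1/2 * (snd (q i) + snd (q j)))"
    have "m \<le> J ?h"
      by (intro mle scale add kq)
    also have "J ?h = (norm (k i + k j))\<^sup>2 / 4 - Re (snd (q i)) - Re (snd (q j))"
      by (simp add: J_def norm_hscale power_mult_distrib power_divide add_divide_distrib)
    finally have "4 * m \<le> (norm (k i + k j))\<^sup>2 - 4 * Re (snd (q i)) - 4 * Re (snd (q j))"
      by simp
    moreover have "(norm (k i + k j))\<^sup>2 + (norm (k i - k j))\<^sup>2 = 2 * (norm (k i))\<^sup>2 + 2 * (norm (k j))\<^sup>2"
      by (simp add: norm_add_sq norm_diff_sq)
    moreover have "(norm (k i))\<^sup>2 - 2 * Re (snd (q i)) < m + inverse (real (Suc i))" for i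
      using q(2)[of i] unfolding J_def k_def split_beta .
    from this[of i] this[of j]
    have "(norm (k i))\<^sup>2 - 2 * Re (snd (q i)) < m + inverse (real (Suc i))"
      "(norm (k j))\<^sup>2 - 2 * Re (snd (q j)) < m + inverse (real (Suc j))" .
    ultimately show ?thesis by argo
  qed
  have "Cauchy k"
  proof (rule metric_CauchyI)
    fix e :: real assume e: "0 < e"
    obtain M where M: "inverse (real (Suc M)) < e\<^sup>2 / 4"
      using reals_Archimedean[of "e\<^sup>2 / 4"] e by auto
    have "dist (k i) (k j) < e" if "M \<le> i" "M \<le> j" for i j
    proof -
      have "inverse (real (Suc i)) \<le> inverse (real (Suc M))" "inverse (real (Suc j)) \<le> inverse (real (Suc M))"
        using that by (auto intro!: le_imp_inverse_le)
      then have "(norm (k i - k j))\<^sup>2 < e\<^sup>2" using para[of i j] M by linarith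
      then show ?thesis using e by (simp add: dist_norm power2_less_imp_less)
    qed
    then show "\<exists>M. \<forall>m\<ge>M. \<forall>n\<ge>M. dist (k m) (k n) < e" by blast
  qed
  then obtain p where p: "k \<longlonglongrightarrow> p" unfolding Cauchy_convergent_iff convergent_def by blast
  have pc: "p \<in> closure (fst ` R)"
    unfolding closure_sequential by (rule exI[of _ k]) (use p q in \<open>auto simp: k_def\<close>)
  have half: "Re (hinner x p) = Re c" if xc: "(x, c) \<in> R" for x c
  proof -
    \<comment> \<open>First-order variation: \<open>J\<close> is at least \<open>m\<close> at
      \<open>k i + t x\<close>, while \<open>J (q i)\<close> exceeds \<open>m\<close> by less than
      1/(i+1), an error that disappears in the limit.\<close>
    have var: "0 \<le> t\<^sup>2 * (norm x)\<^sup>2 + 2 * t * (Re (hinner x p) - Re c)" for t :: real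
    proof (rule tendsto_le[OF sequentially_bot])
      show "(\<lambda>i. t\<^sup>2 * (norm x)\<^sup>2 + 2 * t * (Re (hinner x (k i)) - Re c) + inverse (real (Suc i)))
        \<longlonglongrightarrow> t\<^sup>2 * (norm x)\<^sup>2 + 2 * t * (Re (hinner x p) - Re c)"
      proof (rule tendsto_eq_rhs[OF tendsto_add[OF _ LIMSEQ_inverse_real_of_nat]])
        show "(\<lambda>i. t\<^sup>2 * (norm x)\<^sup>2 + 2 * t * (Re (hinner x (k i)) - Re c))
          \<longlonglongrightarrow> t\<^sup>2 * (norm x)\<^sup>2 + 2 * t * (Re (hinner x p) - Re c)"
          by (intro tendsto_intros tendsto_Re tendsto_hinner p)
      qed simp
      show "(\<lambda>i. 0) \<longlonglongrightarrow> (0::real)" by simp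
      have "0 \<le> t\<^sup>2 * (norm x)\<^sup>2 + 2 * t * (Re (hinner x (k i)) - Re c) + inverse (real (Suc i))" for i
      proof -
        have "m \<le> J (hscale (of_real t) x + k i, of_real t * c + snd (q i))"
          by (intro mle add scale xc kq)
        also have "\<dots> = t\<^sup>2 * (norm x)\<^sup>2 + (norm (k i))\<^sup>2 + 2 * t * Re (hinner x (k i)) - 2 * t * Re c - 2 * Re (snd (q i))"
          by (simp add: J_def norm_add_sq norm_hscale power_mult_distrib hinner_hscale_left)
        also have "\<dots> < t\<^sup>2 * (norm x)\<^sup>2 + 2 * t * Re (hinner x (k i)) - 2 * t * Re c + m + inverse (real (Suc i))"
          using q(2)[of i] unfolding J_def k_def split_beta by linarith
        finally show ?thesis by (simp add: algebra_simps)
      qed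
      then show "\<forall>\<^sub>F i in sequentially. 0 \<le> t\<^sup>2 * (norm x)\<^sup>2 + 2 * t * (Re (hinner x (k i)) - Re c) + inverse (real (Suc i))"
        by simp
    qed
    define a d where "a = (norm x)\<^sup>2" and "d = Re (hinner x p) - Re c"
    \<comment> \<open>This \<open>t\<close> makes the quadratic expression negative unless
      \<open>d = 0\<close>; dividing by \<open>a + 1\<close> rather than \<open>a\<close> covers
      \<open>x = 0\<close>.\<close>
    define t where "t = - d / (a + 1)"
    have a: "0 \<le> a" by (simp add: a_def)
    then have d: "d = - t * (a + 1)" by (simp add: t_def)
    have "0 \<le> t\<^sup>2 * a + 2 * t * d"
      using var[of t] unfolding a_def d_def .
    also have "\<dots> = - (t\<^sup>2 * (a + 2))"
      unfolding d by (simp add: power2_eq_square algebra_simps)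
    finally have "t\<^sup>2 * (a + 2) = 0"
      using a by (intro antisym mult_nonneg_nonneg) auto
    then have "d = 0" using a d by auto
    then show ?thesis by (simp add: d_def)
  qed
  have "hinner x p = c" if xc: "(x, c) \<in> R" for x c
  proof (rule complex_eqI)
    show "Re (hinner x p) = Re c" by (rule half[OF xc])
    \<comment> \<open>Multiplying \<open>x\<close> by -i turns imaginary parts into real
      ones.\<close>
    show "Im (hinner x p) = Im c"
      using half[OF scale[OF xc, of "- \<i>"]] by (simp add: hinner_hscale_left)
  qed
  with pc show ?thesis by auto
qed

text \<open>The foot \<open>p\<close> represents the functional \<open>hinner k x\<close> of
  \<open>k\<close> in \<open>K\<close>; it lies in \<open>K\<close> because \<open>K\<close> is
  closed.\<close>

lemma projection_exists:
  fixes K :: "'a::chilbert set"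
  assumes "csubspace K" "closed K"
  shows "\<exists>p\<in>K. \<forall>k\<in>K. hinner (x - p) k = 0"
proof -
  have "\<exists>p\<in>closure (fst ` {(k, hinner k x) |k. k \<in> K}). \<forall>(k, c)\<in>{(k, hinner k x) |k. k \<in> K}. hinner k p = c"
  proof (rule riesz_closure[where C = "norm x"])
    show "(0, 0) \<in> {(k, hinner k x) |k. k \<in> K}"
      using csubspaceD(1)[OF assms(1)] by (auto intro: exI[of _ 0])
    show "cmod c \<le> norm x * norm k" if "(k, c) \<in> {(k, hinner k x) |k. k \<in> K}" for k c
      using that norm_hinner_le[of k x] by (auto simp: mult.commute)
  next
    fix k c k' c'
    assume "(k, c) \<in> {(k, hinner k x) |k. k \<in> K}" "(k', c') \<in> {(k, hinner k x) |k. k \<in> K}"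
    then show "(k + k', c + c') \<in> {(k, hinner k x) |k. k \<in> K}"
      by (auto simp: hinner_add_left intro: csubspaceD(2)[OF assms(1)])
  next
    fix k c a
    assume "(k, c) \<in> {(k, hinner k x) |k. k \<in> K}"
    then show "(hscale a k, a * c) \<in> {(k, hinner k x) |k. k \<in> K}"
      by (auto simp: hinner_hscale_left intro: csubspaceD(3)[OF assms(1)])
  qed
  moreover have "fst ` {(k, hinner k x) |k. k \<in> K} = K" by (auto simp: image_iff)
  ultimately obtain p where p: "p \<in> K" "\<And>k. k \<in> K \<Longrightarrow> hinner k p = hinner k x"
    using assms(2) by auto
  have "hinner (x - p) k = 0" if "k \<in> K" for k
    using p(2)[OF that] by (metis hinner_commute hinner_diff_left right_minus_eq)
  with p(1) show ?thesis by blast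
qed

section \<open>The Cayley transform\<close>

text \<open>Symmetry makes \<open>hinner (T f) f\<close> real, so the cross term has real part 0.
  Hence B - i and B + i are injective and bounded below.\<close>

lemma norm_shift_sq:
  assumes "symmetric_op D T" "f \<in> D" "s = \<i> \<or> s = - \<i>"
  shows "(norm (T f - hscale s f))\<^sup>2 = (norm (T f))\<^sup>2 + (norm f)\<^sup>2"
proof -
  have "hinner (T f) f = hinner f (T f)" using assms by (simp add: symmetric_op_def)
  then have "hinner (T f) f = cnj (hinner (T f) f)" by (metis hinner_commute)
  from arg_cong[OF this, of Im] have "Im (hinner (T f) f) = 0" by simp
  then show ?thesis using assms(3) by (auto simp: norm_diff_sq norm_hscale hinner_hscale_right)
qed

lemma csubspace_ran_shift:
  assumes "lin_transf D T"
  shows "csubspace (ran_shift D T z)"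
proof -
  have D: "csubspace D" and T: "clinear_on D T" using assms by (auto simp: lin_transf_def)
  have T0: "T 0 = 0" using T csubspaceD(1)[OF D] hscale_zero_left unfolding clinear_on_def by metis
  show ?thesis unfolding csubspace_def
  proof (intro conjI ballI allI)
    show "0 \<in> ran_shift D T z"
      using csubspaceD(1)[OF D] T0 by (auto simp: ran_shift_def intro!: exI[of _ 0])
  next
    fix x y assume "x \<in> ran_shift D T z" "y \<in> ran_shift D T z"
    then obtain f g where fg: "f \<in> D" "g \<in> D" "x = T f - hscale z f" "y = T g - hscale z g"
      by (auto simp: ran_shift_def)
    have "x + y = T (f + g) - hscale z (f + g)"
      using fg T by (simp add: clinear_on_def hscale_add_right)
    then show "x + y \<in> ran_shift D T z"
      using csubspaceD(2)[OF D fg(1,2)] by (auto simp: ran_shift_def)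
  next
    fix c x assume "x \<in> ran_shift D T z"
    then obtain f where f: "f \<in> D" "x = T f - hscale z f" by (auto simp: ran_shift_def)
    have "hscale c x = T (hscale c f) - hscale z (hscale c f)"
      using f T by (simp add: clinear_on_def hscale_diff_right hscale_hscale mult.commute)
    then show "hscale c x \<in> ran_shift D T z"
      using csubspaceD(3)[OF D f(1)] by (auto simp: ran_shift_def)
  qed
qed

lemma shift_diff:
  assumes "lin_transf D T" "f \<in> D" "g \<in> D"
  shows "T (f - g) - hscale z (f - g) = (T f - hscale z f) - (T g - hscale z g)"
proof -
  have D: "csubspace D" and T: "clinear_on D T" using assms by (auto simp: lin_transf_def)
  have "T (f + hscale (-1) g) = T f + hscale (-1) (T g)"
    using T assms csubspaceD(3)[OF D] unfolding clinear_on_def by metis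
  then show ?thesis by (simp add: hscale_one hscale_diff_right)
qed

text \<open>By \<open>norm_shift_sq\<close> the preimages of a Cauchy sequence are again Cauchy, and
  closedness of the graph carries the limit pair.\<close>

lemma closed_ran_shift:
  fixes D :: "'a::chilbert set"
  assumes lin: "lin_transf D T" and sym: "symmetric_op D T" and cl: "closed_op D T"
    and s: "s = \<i> \<or> s = - \<i>"
  shows "closed (ran_shift D T s)"
  unfolding closed_sequential_limits
proof (intro allI impI, elim conjE)
  fix x l assume x: "\<forall>n. x n \<in> ran_shift D T s" and l: "x \<longlonglongrightarrow> l"
  have D: "csubspace D" using lin by (auto simp: lin_transf_def)
  from x have "\<forall>n. \<exists>f. f \<in> D \<and> x n = T f - hscale s f" by (auto simp: ran_shift_def)
  then obtain f where f: "\<And>n. f n \<in> D" "\<And>n. x n = T (f n) - hscale s (f n)" by metis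
  have "norm (f m - f n) \<le> norm (x m - x n)" for m n
  proof -
    have "(norm (x m - x n))\<^sup>2 = (norm (T (f m - f n)))\<^sup>2 + (norm (f m - f n))\<^sup>2"
      using norm_shift_sq[OF sym _ s, of "f m - f n"] shift_diff[OF lin f(1) f(1)]
        csubspaceD(4)[OF D f(1) f(1)] by (simp add: f(2))
    then have "(norm (f m - f n))\<^sup>2 \<le> (norm (x m - x n))\<^sup>2" by simp
    then show ?thesis by (rule power2_le_imp_le) simp
  qed
  moreover have "Cauchy x" using l by (rule LIMSEQ_imp_Cauchy)
  ultimately have "Cauchy f" unfolding Cauchy_def dist_norm by (meson le_less_trans)
  then obtain p where p: "f \<longlonglongrightarrow> p" unfolding Cauchy_convergent_iff convergent_def by blast
  have Tf: "(\<lambda>n. T (f n)) \<longlonglongrightarrow> l + hscale s p"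
  proof (rule Lim_transform_eventually)
    show "(\<lambda>n. x n + hscale s (f n)) \<longlonglongrightarrow> l + hscale s p"
      by (intro tendsto_intros tendsto_hscale l p)
  qed (simp add: f(2))
  have "(p, l + hscale s p) \<in> {(f, T f) | f. f \<in> D}"
  proof (rule closed_sequentially)
    show "closed {(f, T f) | f. f \<in> D}" using cl by (simp add: closed_op_def)
    show "(\<lambda>n. (f n, T (f n))) \<longlonglongrightarrow> (p, l + hscale s p)" by (intro tendsto_Pair p Tf)
  qed (use f in auto)
  then show "l \<in> ran_shift D T s" by (auto simp: ran_shift_def intro!: exI[of _ p] simp: algebra_simps)
qed

text \<open>The difference of \<open>x\<close> and its projection \<open>p\<close> onto
  \<open>R\<close> lies in the complement, so its coefficients are \<open>hinner x (e j)\<close> and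
  the remainder is \<open>p\<close> itself.\<close>

lemma onb_remainder:
  fixes R :: "'a::chilbert set"
  assumes "csubspace R" "closed R" "is_onb_fam e (orth_compl R)"
  shows "x - (\<Sum>j\<in>UNIV. hscale (hinner x (e j)) (e j)) \<in> R"
proof -
  obtain p where p: "p \<in> R" "\<And>k. k \<in> R \<Longrightarrow> hinner (x - p) k = 0"
    using projection_exists[OF assms(1,2), of x] by blast
  have on: "hinner (e i) (e j) = (if i = j then 1 else 0)" for i j
    using assms(3) by (simp add: is_onb_fam_def)
  have span: "orth_compl R = {\<Sum>i\<in>UNIV. hscale (c i) (e i) | c. True}"
    using assms(3) by (simp add: is_onb_fam_def is_basis_fam_def)
  have "x - p \<in> orth_compl R" using p by (simp add: orth_compl_def)
  then obtain c where c: "x - p = (\<Sum>i\<in>UNIV. hscale (c i) (e i))" unfolding span by auto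
  have e: "e j \<in> orth_compl R" for j
    unfolding span
    by (auto intro!: exI[of _ "\<lambda>i. if i = j then 1 else 0"] simp: if_distrib[of "\<lambda>c. hscale c _"] hscale_one cong: if_cong)
  have "hinner x (e j) = c j" for j
  proof -
    have "hinner (e j) p = 0" using e[of j] p(1) by (simp add: orth_compl_def)
    then have "hinner p (e j) = 0" by (metis complex_cnj_zero hinner_commute)
    then have "hinner x (e j) = hinner (x - p) (e j)" by (simp add: hinner_diff_left)
    also have "\<dots> = c j" by (simp add: c hinner_sum_left hinner_hscale_left on if_distrib cong: if_cong)
    finally show ?thesis .
  qed
  then have "x - (\<Sum>j\<in>UNIV. hscale (hinner x (e j)) (e j)) = p" using c by (simp add: algebra_simps)
  with p(1) show ?thesis by simp
qed

lemma is_onb_fam_mem: "is_onb_fam e S \<Longrightarrow> e j \<in> S"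
  unfolding is_onb_fam_def is_basis_fam_def
  by (auto intro!: exI[of _ "\<lambda>i. if i = j then 1 else 0"] simp: if_distrib[of "\<lambda>c. hscale c _"] hscale_one cong: if_cong)

lemma hinner_eq_0_commute: "hinner x y = 0 \<longleftrightarrow> hinner y (x::'a::complex_inner) = 0"
  by (metis complex_cnj_zero hinner_commute)

text \<open>\<open>F\<close> is the inverse of T - s preceded by the orthogonal projection onto
  ran(T - s), which makes it total. Its linearity is checked after applying the injective map T -
  s.\<close>

lemma shift_inverse:
  fixes D :: "'a::chilbert set"
  assumes lin: "lin_transf D T" and sym: "symmetric_op D T" and cl: "closed_op D T"
    and s: "s = \<i> \<or> s = - \<i>" and e: "is_onb_fam e (orth_compl (ran_shift D T s))"
  obtains F where "\<And>x. F x \<in> D"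
    "\<And>x. T (F x) - hscale s (F x) = x - (\<Sum>j\<in>UNIV. hscale (hinner x (e j)) (e j))"
    "\<And>x y. F (x + y) = F x + F y" "\<And>c x. F (hscale c x) = hscale c (F x)"
    "\<And>f. f \<in> D \<Longrightarrow> F (T f - hscale s f) = f"
proof -
  have D: "csubspace D" and T: "clinear_on D T" using lin by (auto simp: lin_transf_def)
  let ?P = "\<lambda>x. \<Sum>j\<in>UNIV. hscale (hinner x (e j)) (e j)"
  have inj: "f = g" if "f \<in> D" "g \<in> D" "T f - hscale s f = T g - hscale s g" for f g
  proof -
    have "(norm (f - g))\<^sup>2 = 0"
      using norm_shift_sq[OF sym csubspaceD(4)[OF D that(1,2)] s] shift_diff[OF lin that(1,2), of s] that(3)
      by (simp add: add_nonneg_eq_0_iff)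
    then show ?thesis by simp
  qed
  have "x - ?P x \<in> ran_shift D T s" for x
    by (intro onb_remainder csubspace_ran_shift closed_ran_shift lin sym cl s e)
  then have "\<forall>x. \<exists>f. f \<in> D \<and> T f - hscale s f = x - ?P x" unfolding ran_shift_def by (auto simp: eq_commute)
  then obtain F where F: "\<And>x. F x \<in> D" "\<And>x. T (F x) - hscale s (F x) = x - ?P x" by metis
  show thesis
  proof (rule that[of F])
    fix x y c
    show "F (x + y) = F x + F y"
    proof (rule inj)
      have "T (F x + F y) = T (F x) + T (F y)" using T F by (simp add: clinear_on_def)
      then have "T (F x + F y) - hscale s (F x + F y) = (T (F x) - hscale s (F x)) + (T (F y) - hscale s (F y))"
        by (simp add: hscale_add_right)
      also have "\<dots> = (x + y) - ?P (x + y)"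
        unfolding F(2) by (simp add: hinner_add_left hscale_add_left sum.distrib)
      finally show "T (F (x + y)) - hscale s (F (x + y)) = T (F x + F y) - hscale s (F x + F y)"
        by (simp add: F(2))
    qed (use F csubspaceD[OF D] in auto)
    show "F (hscale c x) = hscale c (F x)"
    proof (rule inj)
      have "T (hscale c (F x)) = hscale c (T (F x))" using T F by (simp add: clinear_on_def)
      then have "T (hscale c (F x)) - hscale s (hscale c (F x)) = hscale c (T (F x) - hscale s (F x))"
        by (simp add: hscale_diff_right hscale_hscale mult.commute)
      also have "\<dots> = hscale c x - ?P (hscale c x)"
        unfolding F(2) by (simp add: hinner_hscale_left hscale_diff_right hscale_sum_right hscale_hscale)
      finally show "T (F (hscale c x)) - hscale s (F (hscale c x)) = T (hscale c (F x)) - hscale s (hscale c (F x))"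
        by (simp add: F(2))
    qed (use F csubspaceD[OF D] in auto)
  next
    fix f assume f: "f \<in> D"
    then have m: "T f - hscale s f \<in> ran_shift D T s" by (auto simp: ran_shift_def)
    have "hinner (T f - hscale s f) (e j) = 0" for j
      using is_onb_fam_mem[OF e, of j] m unfolding orth_compl_def by (auto simp: hinner_eq_0_commute)
    then have "T (F (T f - hscale s f)) - hscale s (F (T f - hscale s f)) = T f - hscale s f"
      unfolding F(2) by simp
    then show "F (T f - hscale s f) = f" by (rule inj[OF F(1) f])
  qed (rule F)+
qed

text \<open>A partial isometry \<open>V\<close> with adjoint \<open>Vs\<close>; \<open>u\<close> and
  \<open>v\<close> are orthonormal bases of the kernels of \<open>V\<close> and \<open>Vs\<close>.
  The operator B does not occur, so the axioms are symmetric under exchanging \<open>V\<close>,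
  \<open>u\<close> with \<open>Vs\<close>, \<open>v\<close>.\<close>

locale cayley_pair =
  fixes V Vs :: "'a::chilbert \<Rightarrow> 'a" and u v :: "'n::finite \<Rightarrow> 'a"
  assumes V_add: "V (x + y) = V x + V y" and V_scale: "V (hscale c x) = hscale c (V x)"
    and Vs_add: "Vs (x + y) = Vs x + Vs y" and Vs_scale: "Vs (hscale c x) = hscale c (Vs x)"
    and adj: "hinner (V x) y = hinner x (Vs y)"
    and Vs_V: "Vs (V x) = x - (\<Sum>j\<in>UNIV. hscale (hinner x (u j)) (u j))"
    and V_Vs: "V (Vs x) = x - (\<Sum>j\<in>UNIV. hscale (hinner x (v j)) (v j))"
    and u_orthonormal: "hinner (u i) (u j) = (if i = j then 1 else 0)"
    and v_orthonormal: "hinner (v i) (v j) = (if i = j then 1 else 0)"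

text \<open>\<open>V\<close> maps (T + i) f to (T - i) f and vanishes on ker(B^* - i), the
  complement of ran(T + i); \<open>Vs\<close> goes back and vanishes on ker(B^* + i). The other
  conclusions allow dom(B) to be recovered from \<open>V\<close>.\<close>

lemma cayley_pair_exists:
  fixes D :: "'a::chilbert set" and u v :: "'n::finite \<Rightarrow> 'a"
  assumes lin: "lin_transf D T" and sym: "symmetric_op D T" and cl: "closed_op D T"
    and u: "is_onb_fam u (defect D T \<i>)" and v: "is_onb_fam v (defect D T (- \<i>))"
  obtains V Vs where "cayley_pair V Vs u v"
    "\<And>f. f \<in> D \<Longrightarrow> V (T f + hscale \<i> f) = T f - hscale \<i> f"
    "\<And>g. (\<And>j. hinner g (u j) = 0) \<Longrightarrow> \<exists>f\<in>D. g = T f + hscale \<i> f"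
    "\<And>f j. f \<in> D \<Longrightarrow> hinner (T f + hscale \<i> f) (u j) = 0"
proof -
  have u': "is_onb_fam u (orth_compl (ran_shift D T (- \<i>)))" using u by (simp add: defect_def)
  have v': "is_onb_fam v (orth_compl (ran_shift D T \<i>))" using v by (simp add: defect_def)
  have D: "csubspace D" and T: "clinear_on D T" using lin by (auto simp: lin_transf_def)
  obtain F where F': "\<And>x. F x \<in> D"
    "\<And>x. T (F x) - hscale (- \<i>) (F x) = x - (\<Sum>j\<in>UNIV. hscale (hinner x (u j)) (u j))"
    "\<And>x y. F (x + y) = F x + F y" "\<And>c x. F (hscale c x) = hscale c (F x)"
    "\<And>f. f \<in> D \<Longrightarrow> F (T f - hscale (- \<i>) f) = f"
    by (rule shift_inverse[OF lin sym cl disjI2[OF refl] u']) blast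
  note F = F'[unfolded hscale_minus_left diff_minus_eq_add]
  obtain G where G: "\<And>x. G x \<in> D"
    "\<And>x. T (G x) - hscale \<i> (G x) = x - (\<Sum>j\<in>UNIV. hscale (hinner x (v j)) (v j))"
    "\<And>x y. G (x + y) = G x + G y" "\<And>c x. G (hscale c x) = hscale c (G x)"
    "\<And>f. f \<in> D \<Longrightarrow> G (T f - hscale \<i> f) = f"
    by (rule shift_inverse[OF lin sym cl disjI1[OF refl] v']) blast
  define V where "V x = T (F x) - hscale \<i> (F x)" for x
  define Vs where "Vs x = T (G x) + hscale \<i> (G x)" for x
  have ou: "hinner (T f + hscale \<i> f) (u j) = 0" if "f \<in> D" for f j
  proof -
    have "T f + hscale \<i> f \<in> ran_shift D T (- \<i>)" using that by (auto simp: ran_shift_def)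
    then show ?thesis
      using is_onb_fam_mem[OF u', of j] unfolding orth_compl_def by (auto simp: hinner_eq_0_commute)
  qed
  have ov: "hinner (T f - hscale \<i> f) (v j) = 0" if "f \<in> D" for f j
  proof -
    have "T f - hscale \<i> f \<in> ran_shift D T \<i>" using that by (auto simp: ran_shift_def)
    then show ?thesis
      using is_onb_fam_mem[OF v', of j] unfolding orth_compl_def by (auto simp: hinner_eq_0_commute)
  qed
  have "cayley_pair V Vs u v"
  proof
    fix x y c
    show "V (x + y) = V x + V y" "V (hscale c x) = hscale c (V x)"
      "Vs (x + y) = Vs x + Vs y" "Vs (hscale c x) = hscale c (Vs x)"
      using T F(1) G(1) by (simp_all add: V_def Vs_def F(3,4) G(3,4) clinear_on_def hscale_add_right
          hscale_diff_right hscale_hscale mult.commute)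
    show "Vs (V x) = x - (\<Sum>j\<in>UNIV. hscale (hinner x (u j)) (u j))"
      by (simp add: Vs_def V_def G(5)[OF F(1)] F(2))
    show "V (Vs x) = x - (\<Sum>j\<in>UNIV. hscale (hinner x (v j)) (v j))"
      by (simp add: Vs_def V_def F(5)[OF G(1)] G(2))
    \<comment> \<open>Projecting \<open>y\<close> onto ran(T - i) changes nothing, because
      \<open>V x\<close> lies in that range.\<close>
    have "hinner (V x) y = hinner (V x) (T (G y) - hscale \<i> (G y))"
      unfolding G(2) using ov[OF F(1)] by (simp add: V_def hinner_diff_right[of _ y] hinner_sum_right hinner_hscale_right)
    \<comment> \<open>Symmetry of \<open>T\<close> cancels the mixed terms on both sides.\<close>
    also have "\<dots> = hinner (T (F x) + hscale \<i> (F x)) (T (G y) + hscale \<i> (G y))"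
    proof -
      have "hinner (T (F x)) (G y) = hinner (F x) (T (G y))"
        using sym F(1) G(1) by (simp add: symmetric_op_def)
      then show ?thesis by (simp add: V_def hinner_simps) (simp add: algebra_simps)
    qed
    also have "\<dots> = hinner x (T (G y) + hscale \<i> (G y))"
    proof -
      have "hinner (u j) (T (G y) + hscale \<i> (G y)) = 0" for j
        using ou[OF G(1)[of y], of j] by (simp only: hinner_eq_0_commute[of "u j"])
      then have "hinner (\<Sum>j\<in>UNIV. hscale (hinner x (u j)) (u j)) (T (G y) + hscale \<i> (G y)) = 0"
        unfolding hinner_sum_left hinner_hscale_left by simp
      then show ?thesis unfolding F(2) hinner_diff_left[of x] by simp
    qed
    finally show "hinner (V x) y = hinner x (Vs y)" by (simp add: Vs_def)
  next
    show "hinner (u i) (u j) = (if i = j then 1 else 0)" for i j using u unfolding is_onb_fam_def by blast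
    show "hinner (v i) (v j) = (if i = j then 1 else 0)" for i j using v unfolding is_onb_fam_def by blast
  qed
  moreover have "\<exists>f\<in>D. g = T f + hscale \<i> f" if "\<And>j. hinner g (u j) = 0" for g
    using F(1)[of g] F(2)[of g] that by (intro bexI[of _ "F g"]) simp_all
  moreover have "V (T f + hscale \<i> f) = T f - hscale \<i> f" if "f \<in> D" for f
    by (simp add: V_def F(5)[OF that])
  ultimately show thesis using that ou by blast
qed

lemma sum_hscale_delta:
  "(\<Sum>j\<in>UNIV. hscale (if i = j then 1 else 0) (e j)) = (e (i::'n::finite) :: 'a::complex_inner)"
proof -
  have "(\<Sum>j\<in>UNIV. hscale (if i = j then 1 else 0) (e j)) = (\<Sum>j\<in>UNIV. if i = j then e j else 0)"
    by (intro sum.cong) (auto simp: hscale_one)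
  then show ?thesis by simp
qed

context cayley_pair
begin

text \<open>Duality: what is proved for \<open>V\<close>, \<open>u\<close>, \<open>v\<close> becomes
  available for \<open>Vs\<close>, \<open>v\<close>, \<open>u\<close>.\<close>

sublocale swap: cayley_pair Vs V v u
proof
  fix x y
  show "hinner (Vs x) y = hinner x (V y)" by (metis adj hinner_commute)
qed (simp_all add: V_add V_scale Vs_add Vs_scale Vs_V V_Vs u_orthonormal v_orthonormal)

lemma V_zero [simp]: "V 0 = 0"
  using V_scale[of 0 0] by simp

lemma V_diff: "V (x - y) = V x - V y"
  using V_add[of x "hscale (-1) y"] V_scale[of "-1" y] by (simp add: hscale_one)

lemma V_sum: "V (sum f A) = (\<Sum>i\<in>A. V (f i))"
  by (induction A rule: infinite_finite_induct) (auto simp: V_add)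

lemma norm_V_sq: "(norm (V x))\<^sup>2 = (norm x)\<^sup>2 - (\<Sum>j\<in>UNIV. (cmod (hinner x (u j)))\<^sup>2)"
proof -
  have "complex_of_real ((norm (V x))\<^sup>2) = hinner x (Vs (V x))"
    by (simp only: hinner_self[symmetric] adj)
  also have "\<dots> = of_real ((norm x)\<^sup>2) - (\<Sum>j\<in>UNIV. hinner x (u j) * cnj (hinner x (u j)))"
    unfolding Vs_V hinner_diff_right hinner_self by (simp add: hinner_sum_right hinner_hscale_right mult.commute)
  also have "\<dots> = of_real ((norm x)\<^sup>2 - (\<Sum>j\<in>UNIV. (cmod (hinner x (u j)))\<^sup>2))"
    by (simp only: complex_norm_square[symmetric] of_real_sum of_real_diff)
  finally show ?thesis by (simp only: of_real_eq_iff)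
qed

lemma norm_V_le: "norm (V x) \<le> norm x"
proof (rule power2_le_imp_le)
  show "(norm (V x))\<^sup>2 \<le> (norm x)\<^sup>2" by (simp add: norm_V_sq sum_nonneg)
qed simp

lemma V_u [simp]: "V (u j) = 0"
proof -
  have "Vs (V (u j)) = 0" by (simp add: Vs_V u_orthonormal sum_hscale_delta)
  then have "hinner (V (u j)) (V (u j)) = 0" by (simp only: adj hinner_zero_right)
  then show ?thesis by simp
qed

lemma norm_V_pow_le: "norm ((V ^^ m) x) \<le> norm x"
  by (induction m) (auto intro: order_trans[OF norm_V_le])

lemma V_pow_zero [simp]: "(V ^^ m) 0 = 0"
  by (induction m) auto

lemma V_pow_add: "(V ^^ m) (x + y) = (V ^^ m) x + (V ^^ m) y"
  by (induction m) (auto simp: V_add)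

lemma V_pow_diff: "(V ^^ m) (x - y) = (V ^^ m) x - (V ^^ m) y"
  by (induction m) (auto simp: V_diff)

lemma V_pow_scale: "(V ^^ m) (hscale c x) = hscale c ((V ^^ m) x)"
  by (induction m) (auto simp: V_scale)

lemma V_pow_sum: "(V ^^ m) (sum f A) = (\<Sum>i\<in>A. (V ^^ m) (f i))"
  by (induction m) (auto simp: V_sum)

lemma adj_pow: "hinner ((V ^^ m) x) y = hinner x ((Vs ^^ m) y)"
proof (induction m arbitrary: y)
  case (Suc m)
  have "hinner ((V ^^ Suc m) x) y = hinner ((V ^^ m) x) (Vs y)" by (simp add: adj)
  also have "\<dots> = hinner x ((Vs ^^ Suc m) y)" by (simp add: Suc funpow_swap1)
  finally show ?case .
qed simp

text \<open>Iterating \<open>norm_V_sq\<close> telescopes: the norm lost up to time m is the energy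
  emitted through the \<open>u j\<close>.\<close>

lemma V_pow_energy:
  "(norm ((V ^^ m) x))\<^sup>2 = (norm x)\<^sup>2 - (\<Sum>t<m. \<Sum>j\<in>UNIV. (cmod (hinner ((V ^^ t) x) (u j)))\<^sup>2)"
  by (induction m) (auto simp: norm_V_sq)

end

text \<open>Reopening the locale makes the results so far available for \<open>swap\<close>.\<close>

context cayley_pair
begin

section \<open>Defect vectors and the Taylor coefficients of the characteristic function\<close>

lemma expand_in_u:
  assumes "\<And>g. (\<And>j. hinner g (u j) = 0) \<Longrightarrow> hinner g y = 0"
  shows "y = (\<Sum>j\<in>UNIV. hscale (hinner y (u j)) (u j))"
proof -
  let ?g = "y - (\<Sum>j\<in>UNIV. hscale (hinner y (u j)) (u j))"
  \<comment> \<open>Being orthogonal to all \<open>u k\<close>, the vector \<open>?g\<close> is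
    orthogonal to \<open>y\<close> by hypothesis, and therefore to itself.\<close>
  have o: "hinner ?g (u k) = 0" for k
    by (simp add: hinner_diff_left hinner_sum_left hinner_hscale_left u_orthonormal if_distrib cong: if_cong)
  have "hinner ?g ?g = hinner ?g y - (\<Sum>j\<in>UNIV. cnj (hinner y (u j)) * hinner ?g (u j))"
    unfolding hinner_diff_right[of ?g] by (simp only: hinner_sum_right hinner_hscale_right)
  also have "\<dots> = 0" using assms[of ?g] o by simp
  finally show ?thesis by simp
qed

text \<open>As \<open>w\<close> is orthogonal to ran(T - cnj z), the vector (z + i) w - (z - i) Vs w
  is orthogonal to ran(T + i), hence in the span of the \<open>u k\<close>. Since \<open>V\<close>
  kills the \<open>u k\<close>, its coefficients are those of (z + i) w; divide by z + i.\<close>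

lemma defect_fixpoint:
  assumes link: "\<And>f. f \<in> D \<Longrightarrow> V (T f + hscale \<i> f) = T f - hscale \<i> f"
    and ran: "\<And>g. (\<And>j. hinner g (u j) = 0) \<Longrightarrow> \<exists>f\<in>D. g = T f + hscale \<i> f"
    and z: "z \<in> upper_half" and w: "w \<in> defect D T z"
  shows "w = hscale (bfac z) (Vs w) + (\<Sum>k\<in>UNIV. hscale (hinner w (u k)) (u k))"
proof -
  define y where "y = hscale (z + \<i>) w - hscale (z - \<i>) (Vs w)"
  have "hinner g y = 0" if g: "\<And>j. hinner g (u j) = 0" for g
  proof -
    obtain f where f: "f \<in> D" "g = T f + hscale \<i> f" using ran[OF g] by blast
    have "T f - hscale (cnj z) f \<in> ran_shift D T (cnj z)" using f by (auto simp: ran_shift_def)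
    then have "hinner (T f - hscale (cnj z) f) w = 0"
      using w by (auto simp: defect_def orth_compl_def hinner_eq_0_commute)
    then have 0: "hinner (T f) w = cnj z * hinner f w" by (simp add: hinner_simps)
    have "hinner g y = (cnj z - \<i>) * hinner g w - (cnj z + \<i>) * hinner (V g) w"
      by (simp add: y_def hinner_diff_right hinner_hscale_right adj)
    also have "\<dots> = 0" unfolding f(2) link[OF f(1)] by (simp add: hinner_simps 0 algebra_simps)
    finally show ?thesis .
  qed
  then have "y = (\<Sum>k\<in>UNIV. hscale (hinner y (u k)) (u k))" by (rule expand_in_u)
  moreover have "hinner y (u k) = (z + \<i>) * hinner w (u k)" for k
    by (simp add: y_def hinner_diff_left hinner_hscale_left swap.adj)
  ultimately have "y = hscale (z + \<i>) (\<Sum>k\<in>UNIV. hscale (hinner w (u k)) (u k))"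
    by (simp add: hscale_sum_right hscale_hscale)
  then have e: "hscale (z + \<i>) w = hscale (z - \<i>) (Vs w) + hscale (z + \<i>) (\<Sum>k\<in>UNIV. hscale (hinner w (u k)) (u k))"
    by (simp add: y_def algebra_simps)
  have nz: "z + \<i> \<noteq> 0" using z by (auto simp: upper_half_def complex_eq_iff)
  then have "w = hscale (1 / (z + \<i>)) (hscale (z + \<i>) w)" by (simp add: hscale_hscale hscale_one)
  also have "\<dots> = hscale (bfac z) (Vs w) + (\<Sum>k\<in>UNIV. hscale (hinner w (u k)) (u k))"
    unfolding e hscale_add_right hscale_hscale using nz by (simp add: bfac_def hscale_one)
  finally show ?thesis .
qed

text \<open>Iterating the equation leaves the remainder b^N V^N w, which tends to 0 because
  \<open>V\<close> is a contraction. Pairing with \<open>y\<close> keeps the series scalar.\<close>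

lemma neumann_sums:
  assumes w: "w = hscale b (V w) + p" and b: "cmod b < 1"
  shows "(\<lambda>t. b ^ t * hinner ((V ^^ t) p) y) sums hinner w y"
proof -
  have part: "hinner w y = (\<Sum>t<N. b ^ t * hinner ((V ^^ t) p) y) + b ^ N * hinner ((V ^^ N) w) y" for N
  proof (induction N)
    case (Suc N)
    have "(V ^^ N) w = hscale b ((V ^^ Suc N) w) + (V ^^ N) p"
      by (subst w) (simp add: V_pow_add V_pow_scale funpow_swap1)
    then have "hinner ((V ^^ N) w) y = b * hinner ((V ^^ Suc N) w) y + hinner ((V ^^ N) p) y"
      by (metis hinner_add_left hinner_hscale_left)
    then show ?case unfolding Suc by (simp add: algebra_simps)
  qed simp
  have "(\<lambda>N. b ^ N * hinner ((V ^^ N) w) y) \<longlonglongrightarrow> 0"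
  proof (rule Lim_null_comparison)
    show "\<forall>\<^sub>F N in sequentially. norm (b ^ N * hinner ((V ^^ N) w) y) \<le> cmod b ^ N * (norm w * norm y)"
      by (intro always_eventually allI)
        (auto simp: norm_mult norm_power intro!: mult_left_mono order_trans[OF norm_hinner_le] mult_right_mono norm_V_pow_le)
    show "(\<lambda>N. cmod b ^ N * (norm w * norm y)) \<longlonglongrightarrow> 0"
      using b by (intro tendsto_mult_left_zero LIMSEQ_realpow_zero) auto
  qed
  then have "(\<lambda>N. hinner w y - b ^ N * hinner ((V ^^ N) w) y) \<longlonglongrightarrow> hinner w y - 0"
    by (intro tendsto_intros)
  moreover have "(\<lambda>N. hinner w y - b ^ N * hinner ((V ^^ N) w) y) = (\<lambda>N. \<Sum>t<N. b ^ t * hinner ((V ^^ t) p) y)"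
    using part by (auto simp: algebra_simps)
  ultimately show ?thesis by (simp add: sums_def)
qed

end

lemma norm_bfac_less_1: "z \<in> upper_half \<Longrightarrow> cmod (bfac z) < 1"
proof -
  assume z: "z \<in> upper_half"
  have "(cmod (z - \<i>))\<^sup>2 < (cmod (z + \<i>))\<^sup>2"
    unfolding cmod_power2 using z by (simp add: upper_half_def power2_eq_square algebra_simps)
  then have "cmod (z - \<i>) < cmod (z + \<i>)" by (rule power2_less_imp_less) simp
  moreover from this have "0 < cmod (z + \<i>)" using norm_ge_zero[of "z - \<i>"] by linarith
  ultimately show ?thesis by (simp add: bfac_def norm_divide)
qed

text \<open>Expanding the defect vectors with \<open>defect_fixpoint\<close> and
  \<open>neumann_sums\<close> gives A = B S, where S has the entries sum_t b^t <Vs^t u_l, v_k>. So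
  the inverse of B times A is S, whatever basis \<open>w z\<close> was chosen.\<close>

lemma livsic_cf_coeffs:
  fixes \<Theta> :: "complex \<Rightarrow> complex^'n::finite^'n"
  assumes lin: "lin_transf D T" and sym: "symmetric_op D T" and cl: "closed_op D T"
    and cf: "livsic_cf D T \<Theta>"
  obtains V Vs and u v :: "'n \<Rightarrow> 'a::chilbert" where "cayley_pair V Vs u v"
    "\<And>f. f \<in> D \<Longrightarrow> V (T f + hscale \<i> f) = T f - hscale \<i> f"
    "\<And>g. (\<And>j. hinner g (u j) = 0) \<Longrightarrow> \<exists>f\<in>D. g = T f + hscale \<i> f"
    "\<And>f j. f \<in> D \<Longrightarrow> hinner (T f + hscale \<i> f) (u j) = 0"
    "\<And>z j k. z \<in> upper_half \<Longrightarrow> (\<lambda>t. bfac z ^ Suc t * hinner ((Vs ^^ t) (u j)) (v k)) sums \<Theta> z $ j $ k"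
proof -
  obtain u v :: "'n \<Rightarrow> 'a" and w :: "complex \<Rightarrow> 'n \<Rightarrow> 'a" where u: "is_onb_fam u (defect D T \<i>)" and v: "is_onb_fam v (defect D T (- \<i>))"
    and W: "\<forall>z\<in>upper_half. is_basis_fam (w z) (defect D T z) \<and>
      \<Theta> z = (\<chi> j k. bfac z * (matrix_inv (\<chi> j k. hinner (w z j) (u k)) **
       (\<chi> j k. hinner (w z j) (v k))) $ j $ k)"
    using cf unfolding livsic_cf_def Let_def by blast
  have w: "is_basis_fam (w z) (defect D T z)" if "z \<in> upper_half" for z
    using W that by blast
  have \<Theta>: "\<Theta> z = (\<chi> j k. bfac z * (matrix_inv (\<chi> j k. hinner (w z j) (u k)) **
       (\<chi> j k. hinner (w z j) (v k))) $ j $ k)" if "z \<in> upper_half" for z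
    using W that by blast
  obtain V Vs where cp: "cayley_pair V Vs u v"
    and link: "\<And>f. f \<in> D \<Longrightarrow> V (T f + hscale \<i> f) = T f - hscale \<i> f"
    and ran: "\<And>g. (\<And>j. hinner g (u j) = 0) \<Longrightarrow> \<exists>f\<in>D. g = T f + hscale \<i> f"
    and ort: "\<And>f j. f \<in> D \<Longrightarrow> hinner (T f + hscale \<i> f) (u j) = 0"
    using cayley_pair_exists[OF lin sym cl u v] by blast
  interpret cayley_pair V Vs u v by (rule cp)
  have "(\<lambda>t. bfac z ^ Suc t * hinner ((Vs ^^ t) (u j)) (v k)) sums \<Theta> z $ j $ k" if z: "z \<in> upper_half" for z j k
  proof -
    define b where "b = bfac z"
    have b: "cmod b < 1" using z norm_bfac_less_1 by (simp add: b_def)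
    define B where "B = (\<chi> j k. hinner (w z j) (u k))"
    define A where "A = (\<chi> j k. hinner (w z j) (v k))"
    define S :: "complex^'n^'n" where "S = (\<chi> l k. \<Sum>t. b ^ t * hinner ((Vs ^^ t) (u l)) (v k))"
    have mem: "w z j \<in> defect D T z" for j
      using w[OF z] unfolding is_basis_fam_def
      by (auto intro!: exI[of _ "\<lambda>i. if j = i then 1 else 0"] sum_hscale_delta[symmetric])
    have fixp: "w z j = hscale b (Vs (w z j)) + (\<Sum>l\<in>UNIV. hscale (B $ j $ l) (u l))" for j
      using defect_fixpoint[OF link ran z mem] by (simp add: b_def B_def)
    have Ssum: "(\<lambda>t. b ^ t * hinner ((Vs ^^ t) (u l)) (v k)) sums S $ l $ k" for l k
    proof -
      have nu: "norm (u l) = 1" "norm (v k) = 1"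
        by (simp_all add: norm_eq_sqrt_hinner u_orthonormal v_orthonormal)
      have "cmod (hinner ((Vs ^^ t) (u l)) (v k)) \<le> 1" for t
        using norm_hinner_le[of "(Vs ^^ t) (u l)" "v k"] swap.norm_V_pow_le[of t "u l"] nu by simp
      then have "summable (\<lambda>t. b ^ t * hinner ((Vs ^^ t) (u l)) (v k))"
        by (intro summable_comparison_test'[OF summable_geometric[of "cmod b"]])
          (use b in \<open>auto simp: norm_mult norm_power intro: mult_left_le\<close>)
      then show ?thesis by (simp add: S_def summable_sums)
    qed
    have "A = B ** S"
    proof -
      have "A $ j $ k = (B ** S) $ j $ k" for j k
      proof (rule sums_unique2)
        show "(\<lambda>t. b ^ t * hinner ((Vs ^^ t) (\<Sum>l\<in>UNIV. hscale (B $ j $ l) (u l))) (v k)) sums A $ j $ k"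
          unfolding A_def using swap.neumann_sums[OF fixp b] by simp
        have "(\<lambda>t. \<Sum>l\<in>UNIV. B $ j $ l * (b ^ t * hinner ((Vs ^^ t) (u l)) (v k))) sums (\<Sum>l\<in>UNIV. B $ j $ l * S $ l $ k)"
          by (intro sums_sum sums_mult Ssum)
        then show "(\<lambda>t. b ^ t * hinner ((Vs ^^ t) (\<Sum>l\<in>UNIV. hscale (B $ j $ l) (u l))) (v k)) sums (B ** S) $ j $ k"
          by (simp add: matrix_matrix_mult_def swap.V_pow_sum swap.V_pow_scale hinner_sum_left hinner_hscale_left
              sum_distrib_left mult_ac)
      qed
      then show ?thesis by (simp add: vec_eq_iff)
    qed
    have "invertible B"
    proof -
      \<comment> \<open>A vanishing combination of the rows of \<open>B\<close> yields a defect
        vector \<open>y\<close> orthogonal to all \<open>u k\<close>; then y = b Vs y forces y = 0,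
        and linear independence of \<open>w z\<close> gives x = 0.\<close>
      have "x = 0" if "transpose B *v x = 0" for x
      proof -
        have c0: "(\<Sum>j\<in>UNIV. x $ j * B $ j $ k) = 0" for k
          using arg_cong[OF that, of "\<lambda>y. y $ k"] by (simp add: matrix_vector_mult_def transpose_def mult.commute)
        define y where "y = (\<Sum>j\<in>UNIV. hscale (x $ j) (w z j))"
        have "y \<in> defect D T z" using w[OF z] unfolding is_basis_fam_def y_def by blast
        moreover have "hinner y (u k) = 0" for k
          using c0[of k] by (simp add: y_def hinner_sum_left hinner_hscale_left B_def)
        ultimately have "y = hscale b (Vs y) + 0"
          using defect_fixpoint[OF link ran z, of y] by (simp add: b_def)
        from swap.neumann_sums[OF this b, of y] have "hinner y y = 0"
          by (simp add: sums_iff)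
        then have "y = 0" by simp
        then show ?thesis using w[OF z] unfolding is_basis_fam_def y_def by (auto simp: vec_eq_iff)
      qed
      then have "invertible (transpose B)"
        unfolding invertible_left_inverse matrix_left_invertible_ker by blast
      then show ?thesis
        by (metis invertible_def matrix_transpose_mul transpose_mat transpose_transpose)
    qed
    then have "matrix_inv B ** B = mat 1"
      unfolding invertible_def matrix_inv_def by (metis (mono_tags, lifting) someI_ex)
    then have "matrix_inv B ** A = S" by (simp add: \<open>A = B ** S\<close> matrix_mul_assoc)
    then have "\<Theta> z $ j $ k = b * S $ j $ k" using \<Theta>[OF z] by (simp add: b_def A_def B_def)
    with sums_mult[OF Ssum, of b j k] show ?thesis by (simp add: b_def mult.assoc)
  qed
  with cp link ran ort show thesis using that by blast
qed

lemma csubspace_sum: "csubspace S \<Longrightarrow> (\<And>i. i \<in> A \<Longrightarrow> f i \<in> S) \<Longrightarrow> sum f A \<in> S"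
  by (induction A rule: infinite_finite_induct) (auto intro: csubspaceD(1,2))

section \<open>Asymptotics of powers and the energy balance\<close>

lemma closed_orth_compl: "closed (orth_compl S :: 'a::complex_inner set)"
proof -
  have "orth_compl S = (\<Inter>y\<in>S. {x. hinner x y = 0})" by (auto simp: orth_compl_def)
  moreover have "closed {x. hinner x y = 0}" for y :: 'a
    by (intro closed_Collect_eq continuous_on_hinner continuous_intros)
  ultimately show ?thesis by auto
qed

lemma csubspace_orth_compl: "csubspace (orth_compl S)"
  by (auto simp: csubspace_def orth_compl_def hinner_add_left hinner_hscale_left)

context cayley_pair
begin

text \<open>Banach's theorem is applied inside the closed invariant subspace \<open>M\<close>, so
  that the solution of the resolvent equation stays in \<open>M\<close>.\<close>

lemma affine_fixpoint:
  assumes M: "csubspace M" "closed M" and inv: "\<And>x. x \<in> M \<Longrightarrow> V x \<in> M"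
    and a: "a \<in> M" and c: "cmod c < 1"
  shows "\<exists>x\<in>M. x = a + hscale c (V x)"
proof -
  have "\<exists>!x\<in>M. a + hscale c (V x) = x"
  proof (rule Banach_fix[OF _ _ norm_ge_zero c])
    show "complete M" using M(2) by (simp add: complete_eq_closed)
    show "M \<noteq> {}" using a by blast
    show "(\<lambda>x. a + hscale c (V x)) ` M \<subseteq> M"
      using a inv csubspaceD(2,3)[OF M(1)] by blast
    fix x y
    show "dist (a + hscale c (V x)) (a + hscale c (V y)) \<le> cmod c * dist x y"
      using norm_V_le[of "x - y"] mult_left_mono[of "norm (V x - V y)" "norm (x - y)" "cmod c"]
      by (simp add: dist_norm hscale_diff_right[symmetric] norm_hscale V_diff)
  qed
  then show ?thesis by (metis)
qed

end

context cayley_pair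
begin

text \<open>If g = (T + i) f then V g = (T - i) f, and (i - z) g + (i + z) V g = 2i (T - z) f. This
  expresses ran(B - z) through \<open>V\<close>.\<close>

lemma mem_ran_shift:
  assumes link: "\<And>f. f \<in> D \<Longrightarrow> V (T f + hscale \<i> f) = T f - hscale \<i> f"
    and ran: "\<And>g. (\<And>j. hinner g (u j) = 0) \<Longrightarrow> \<exists>f\<in>D. g = T f + hscale \<i> f"
    and g: "\<And>j. hinner g (u j) = 0"
    and h: "hscale (\<i> - z) g + hscale (\<i> + z) (V g) = hscale (2 * \<i>) h"
  shows "h \<in> ran_shift D T z"
proof -
  obtain f where f: "f \<in> D" "g = T f + hscale \<i> f" using ran[OF g] by blast
  have "hscale (\<i> - z) g + hscale (\<i> + z) (V g)
      = hscale ((\<i> - z) + (\<i> + z)) (T f) + hscale ((\<i> - z) * \<i> - (\<i> + z) * \<i>) f"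
    unfolding f(2) link[OF f(1)] hscale_add_right hscale_diff_right hscale_add_left hscale_diff_left hscale_hscale
    by simp
  also have "\<dots> = hscale (2 * \<i>) (T f - hscale z f)"
  proof -
    have e: "(\<i> - z) + (\<i> + z) = 2 * \<i>" "(\<i> - z) * \<i> - (\<i> + z) * \<i> = - (2 * \<i> * z)"
      by (simp_all add: algebra_simps)
    show ?thesis unfolding e by (simp add: hscale_diff_right hscale_hscale)
  qed
  finally have "hscale (1 / (2 * \<i>)) (hscale (2 * \<i>) h) = hscale (1 / (2 * \<i>)) (hscale (2 * \<i>) (T f - hscale z f))"
    using h by simp
  then have "h = T f - hscale z f" by (simp add: hscale_hscale hscale_one)
  then show ?thesis using f(1) by (auto simp: ran_shift_def)
qed

text \<open>The set of \<open>h\<close> with \<open>V\<^sup>m h \<longrightarrow> 0\<close> reduces \<open>V\<close> and contains both defect spaces, so \<open>V\<close> is unitary on its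
  complement, which therefore lies in every \<open>ran (B - z)\<close>.\<close>

lemma V_pow_tendsto_0:
  assumes link: "\<And>f. f \<in> D \<Longrightarrow> V (T f + hscale \<i> f) = T f - hscale \<i> f"
    and ran: "\<And>g. (\<And>j. hinner g (u j) = 0) \<Longrightarrow> \<exists>f\<in>D. g = T f + hscale \<i> f"
    and simple: "simple_op D T"
    and v0: "\<And>k. (\<lambda>m. (V ^^ m) (v k)) \<longlonglongrightarrow> 0"
  shows "(\<lambda>m. (V ^^ m) h) \<longlonglongrightarrow> 0"
proof -
  define Z where "Z = {h. (\<lambda>m. (V ^^ m) h) \<longlonglongrightarrow> 0}"
  have Z: "csubspace Z"
    unfolding csubspace_def Z_def
    using tendsto_hscale[OF tendsto_const] by (auto simp: V_pow_add V_pow_scale intro: tendsto_add_zero) fastforce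
  have u: "u j \<in> Z" for j
  proof -
    have "(V ^^ Suc m) (u j) = 0" for m by (simp add: funpow_swap1[of V])
    then have "(\<lambda>m. (V ^^ Suc m) (u j)) \<longlonglongrightarrow> 0" by simp
    then show ?thesis unfolding Z_def mem_Collect_eq by (rule LIMSEQ_imp_Suc)
  qed
  have v: "v j \<in> Z" for j using v0 by (simp add: Z_def)
  have VZ: "V h \<in> Z" if "h \<in> Z" for h
  proof -
    have "(\<lambda>m. (V ^^ Suc m) h) \<longlonglongrightarrow> 0"
      using that by (intro LIMSEQ_Suc) (simp add: Z_def)
    then show ?thesis by (simp add: Z_def funpow_swap1)
  qed
  \<comment> \<open>\<open>V (Vs h)\<close> differs from \<open>h\<close> by a combination of the
    \<open>v j\<close>, which lie in \<open>Z\<close>; one power of \<open>V\<close> more or less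
    does not affect the limit.\<close>
  have VsZ: "Vs h \<in> Z" if "h \<in> Z" for h
  proof -
    have "(\<Sum>j\<in>UNIV. hscale (hinner h (v j)) (v j)) \<in> Z"
      using csubspaceD(1-3)[OF Z] v by (intro csubspace_sum[OF Z]) auto
    then have "V (Vs h) \<in> Z" unfolding V_Vs by (rule csubspaceD(4)[OF Z that])
    then have "(\<lambda>m. (V ^^ Suc m) (Vs h)) \<longlonglongrightarrow> 0" by (simp add: Z_def funpow_swap1)
    then show ?thesis unfolding Z_def mem_Collect_eq by (rule LIMSEQ_imp_Suc)
  qed
  \<comment> \<open>All powers of \<open>V\<close> are contractions, so approximating
    \<open>l\<close> by \<open>x n\<close> is uniform in \<open>m\<close>.\<close>
  have "closed Z"
    unfolding closed_sequential_limits
  proof (intro allI impI, elim conjE)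
    fix x l assume x: "\<forall>n. x n \<in> Z" and l: "x \<longlonglongrightarrow> l"
    show "l \<in> Z" unfolding Z_def mem_Collect_eq
    proof (rule LIMSEQ_I)
      fix e :: real assume e: "0 < e"
      obtain n where n: "norm (x n - l) < e / 2" using LIMSEQ_D[OF l, of "e / 2"] e by auto
      have "(\<lambda>m. (V ^^ m) (x n)) \<longlonglongrightarrow> 0" using x by (simp add: Z_def)
      then obtain N where N: "\<And>m. m \<ge> N \<Longrightarrow> norm ((V ^^ m) (x n)) < e / 2"
        using LIMSEQ_D[of _ 0 "e / 2"] e by fastforce
      have "norm ((V ^^ m) l - 0) < e" if "m \<ge> N" for m
      proof -
        have "norm ((V ^^ m) l) \<le> norm ((V ^^ m) (x n)) + norm ((V ^^ m) (x n - l))"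
          unfolding V_pow_diff by (metis norm_minus_commute norm_triangle_sub)
        also have "\<dots> < e / 2 + e / 2"
          using N[OF that] norm_V_pow_le[of m "x n - l"] n by linarith
        finally show ?thesis by simp
      qed
      then show "\<exists>N. \<forall>m\<ge>N. norm ((V ^^ m) l - 0) < e" by blast
    qed
  qed
  define M where "M = orth_compl Z"
  have M: "csubspace M" "closed M" by (simp_all add: M_def csubspace_orth_compl closed_orth_compl)
  have MV: "V x \<in> M" if "x \<in> M" for x
    using that VsZ by (auto simp: M_def orth_compl_def adj)
  have MVs: "Vs x \<in> M" if "x \<in> M" for x
    using that VZ by (auto simp: M_def orth_compl_def swap.adj)
  have Mu: "hinner x (u j) = 0" if "x \<in> M" for x j using that u by (auto simp: M_def orth_compl_def)
  have Mv: "hinner x (v j) = 0" if "x \<in> M" for x j using that v by (auto simp: M_def orth_compl_def)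
  have "M \<subseteq> ran_shift D T z" if z: "Im z \<noteq> 0" for z
  proof
    fix h assume h: "h \<in> M"
    show "h \<in> ran_shift D T z"
    proof (cases "Im z > 0")
      case True
      then have nz: "\<i> + z \<noteq> 0" by (auto simp: complex_eq_iff)
      have c: "cmod (bfac z) < 1" using True by (simp add: norm_bfac_less_1 upper_half_def)
      \<comment> \<open>With g = Vs x and V g = x on \<open>M\<close>, the equation of
        \<open>mem_ran_shift\<close> reads (i + z) x = 2i h + (z - i) Vs x; dividing by i + z leaves
        the factor b(z), of modulus below 1.\<close>
      obtain x where x: "x \<in> M" "x = hscale (2 * \<i> / (\<i> + z)) h + hscale (bfac z) (Vs x)"
        using swap.affine_fixpoint[OF M MVs _ c] csubspaceD(3)[OF M(1) h] by blast
      have g: "V (Vs x) = x" using Mv[OF x(1)] by (simp add: V_Vs)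
      have "hscale (\<i> + z) x = hscale (2 * \<i>) h + hscale (z - \<i>) (Vs x)"
        by (subst x(2)) (use nz in \<open>simp add: hscale_add_right hscale_hscale bfac_def add.commute[of z]\<close>)
      then have "hscale (\<i> - z) (Vs x) + hscale (\<i> + z) (V (Vs x)) = hscale (2 * \<i>) h"
        by (simp add: g hscale_diff_left)
      then show ?thesis using Mu[OF MVs[OF x(1)]] by (intro mem_ran_shift[OF link ran])
    next
      case False
      then have z: "Im (- z) > 0" using z by simp
      then have nz: "\<i> - z \<noteq> 0" by (auto simp: complex_eq_iff)
      have c: "cmod (bfac (- z)) < 1" using z by (simp add: norm_bfac_less_1 upper_half_def)
      \<comment> \<open>Here g = x itself; dividing by i - z leaves the factor -(i + z)/(i - z) =
        b(-z), of modulus below 1 in the lower half-plane.\<close>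
      obtain x where x: "x \<in> M" "x = hscale (2 * \<i> / (\<i> - z)) h + hscale (bfac (- z)) (V x)"
        using affine_fixpoint[OF M MV _ c] csubspaceD(3)[OF M(1) h] by blast
      have b: "(\<i> - z) * bfac (- z) = - (\<i> + z)"
        using nz by (simp add: bfac_def field_simps)
      have "hscale (\<i> - z) x = hscale (2 * \<i>) h - hscale (\<i> + z) (V x)"
        by (subst x(2)) (use nz b in \<open>simp add: hscale_add_right hscale_hscale del: minus_add_distrib\<close>)
      then have "hscale (\<i> - z) x + hscale (\<i> + z) (V x) = hscale (2 * \<i>) h" by simp
      then show ?thesis using Mu[OF x(1)] by (intro mem_ran_shift[OF link ran])
    qed
  qed
  \<comment> \<open>By simplicity the ranges meet only in 0, so every \<open>h\<close> equals its
    projection onto \<open>Z\<close>.\<close>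
  then have "M \<subseteq> {0}" using simple unfolding simple_op_def by blast
  obtain p where p: "p \<in> Z" "\<And>k. k \<in> Z \<Longrightarrow> hinner (h - p) k = 0"
    using projection_exists[OF Z \<open>closed Z\<close>, of h] by blast
  then have "h - p \<in> M" by (simp add: M_def orth_compl_def)
  with \<open>M \<subseteq> {0}\<close> have "h = p" by auto
  with p(1) show ?thesis by (simp add: Z_def)
qed

text \<open>The system starts at rest. Inputs are formal power series, so that composing systems
  becomes multiplying series; the input with index t first acts on the state at time t + 1.\<close>

fun state :: "('n \<Rightarrow> complex fps) \<Rightarrow> nat \<Rightarrow> 'a" where
  "state d 0 = 0"
| "state d (Suc t) = Vs (state d t) + (\<Sum>j\<in>UNIV. hscale (fps_nth (d j) t) (u j))"

text \<open>Impulse response from input j to output k. The zero constant term is the delay of one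
  step and accounts for the factor b(z) in the characteristic function.\<close>

definition transfer :: "'n \<Rightarrow> 'n \<Rightarrow> complex fps" where
  "transfer j k = Abs_fps (\<lambda>t. case t of 0 \<Rightarrow> 0 | Suc s \<Rightarrow> hinner ((Vs ^^ s) (u j)) (v k))"

lemma state_add: "state (\<lambda>j. d j + d' j) t = state d t + state d' t"
  by (induction t) (auto simp: Vs_add hscale_add_left sum.distrib)

lemma state_scale: "state (\<lambda>j. fps_const c * d j) t = hscale c (state d t)"
  by (induction t) (auto simp: Vs_scale hscale_add_right hscale_sum_right hscale_hscale)

text \<open>Superposition of the inputs. The vector \<open>y\<close> is arbitrary so that the
  induction can move \<open>Vs\<close> over to it as \<open>V\<close>.\<close>

lemma hinner_state:
  "hinner (state d t) y = (\<Sum>i<t. \<Sum>j\<in>UNIV. fps_nth (d j) i * hinner ((Vs ^^ (t - Suc i)) (u j)) y)"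
proof (induction t arbitrary: y)
  case (Suc t)
  have "hinner (state d (Suc t)) y = hinner (state d t) (V y) + (\<Sum>j\<in>UNIV. fps_nth (d j) t * hinner (u j) y)"
    by (simp add: hinner_add_left hinner_sum_left hinner_hscale_left swap.adj)
  also have "hinner (state d t) (V y) = (\<Sum>i<t. \<Sum>j\<in>UNIV. fps_nth (d j) i * hinner ((Vs ^^ (Suc t - Suc i)) (u j)) y)"
    unfolding Suc
  proof (intro sum.cong refl)
    fix i j assume "i \<in> {..<t}"
    then have "Suc t - Suc i = Suc (t - Suc i)" by auto
    then show "fps_nth (d j) i * hinner ((Vs ^^ (t - Suc i)) (u j)) (V y) =
        fps_nth (d j) i * hinner ((Vs ^^ (Suc t - Suc i)) (u j)) y"
      by (simp add: swap.adj)
  qed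
  finally show ?case by simp
qed simp

lemma hinner_state_v: "hinner (state d t) (v k) = fps_nth (\<Sum>j\<in>UNIV. d j * transfer j k) t"
proof -
  have "fps_nth (d j * transfer j k) t = (\<Sum>i<t. fps_nth (d j) i * hinner ((Vs ^^ (t - Suc i)) (u j)) (v k))" for j
  proof -
    have "fps_nth (d j * transfer j k) t = (\<Sum>i\<in>{0..t}. fps_nth (d j) i * fps_nth (transfer j k) (t - i))"
      by (simp add: fps_mult_nth)
    \<comment> \<open>The term i = t drops out because \<open>transfer j k\<close> has no constant
      term.\<close>
    also have "\<dots> = (\<Sum>i<t. fps_nth (d j) i * fps_nth (transfer j k) (t - i))"
      by (intro sum.mono_neutral_right) (auto simp: transfer_def)
    also have "\<dots> = (\<Sum>i<t. fps_nth (d j) i * hinner ((Vs ^^ (t - Suc i)) (u j)) (v k))"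
    proof (intro sum.cong refl)
      fix i assume "i \<in> {..<t}"
      then have "t - i = Suc (t - Suc i)" by auto
      then show "fps_nth (d j) i * fps_nth (transfer j k) (t - i) = fps_nth (d j) i * hinner ((Vs ^^ (t - Suc i)) (u j)) (v k)"
        by (simp add: transfer_def)
    qed
    finally show ?thesis .
  qed
  then show ?thesis
    by (simp add: hinner_state fps_sum_nth sum.swap[of _ "{..<t}"])
qed

text \<open>Applying \<open>Vs\<close> loses exactly the output energy, and the new input is added
  orthogonally to ran Vs because V u_j = 0.\<close>

lemma state_energy:
  "(norm (state d t))\<^sup>2 = (\<Sum>i<t. \<Sum>j\<in>UNIV. (cmod (fps_nth (d j) i))\<^sup>2)
    - (\<Sum>i<t. \<Sum>k\<in>UNIV. (cmod (fps_nth (\<Sum>j\<in>UNIV. d j * transfer j k) i))\<^sup>2)"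
proof (induction t)
  case (Suc t)
  let ?x = "Vs (state d t)" and ?y = "\<Sum>j\<in>UNIV. hscale (fps_nth (d j) t) (u j)"
  have "hinner ?x ?y = 0"
    by (simp add: hinner_sum_right hinner_hscale_right swap.adj)
  then have "(norm (state d (Suc t)))\<^sup>2 = (norm ?x)\<^sup>2 + (norm ?y)\<^sup>2" by (simp add: norm_add_sq)
  also have "(norm ?y)\<^sup>2 = (\<Sum>j\<in>UNIV. (cmod (fps_nth (d j) t))\<^sup>2)"
  proof -
    have "hinner ?y ?y = (\<Sum>j\<in>UNIV. fps_nth (d j) t * cnj (fps_nth (d j) t))"
      by (simp add: hinner_sum_left hinner_sum_right hinner_hscale_left hinner_hscale_right u_orthonormal
          if_distrib mult.commute cong: if_cong)
    also have "\<dots> = of_real (\<Sum>j\<in>UNIV. (cmod (fps_nth (d j) t))\<^sup>2)"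
      by (simp only: complex_norm_square[symmetric] of_real_sum)
    finally show ?thesis unfolding hinner_self of_real_eq_iff .
  qed
  also have "(norm ?x)\<^sup>2 = (norm (state d t))\<^sup>2 - (\<Sum>k\<in>UNIV. (cmod (fps_nth (\<Sum>j\<in>UNIV. d j * transfer j k) t))\<^sup>2)"
    by (simp only: swap.norm_V_sq hinner_state_v)
  finally show ?case using Suc by simp
qed simp

end

context cayley_pair
begin

text \<open>Multiplication by X^s postpones the input, and the system rests until then. Delays bring
  two reachable states to a common time, so reachable states can be added.\<close>

lemma state_delay: "state (\<lambda>j. fps_X ^ s * d j) (t + s) = state d t"
proof (induction s)
  case (Suc s)
  have "state (\<lambda>j. fps_X * d' j) (Suc t) = state d' t" for d' t
    by (induction t) auto
  from this[of "\<lambda>j. fps_X ^ s * d j" "t + s"] show ?case using Suc by (simp add: mult.assoc)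
qed simp

lemma state_impulse: "state (\<lambda>i. if i = j then 1 else 0) (Suc t) = (Vs ^^ t) (u j)"
proof (induction t)
  case 0
  have "(\<Sum>i\<in>UNIV. hscale (fps_nth (if i = j then 1 else 0) 0) (u i)) = (\<Sum>i\<in>UNIV. if i = j then u i else 0)"
    by (intro sum.cong) (auto simp: hscale_one)
  then show ?case by simp
next
  case (Suc t)
  have "(\<Sum>i\<in>UNIV. hscale (fps_nth (if i = j then 1 else 0) (Suc t)) (u i)) = 0"
    by (intro sum.neutral) auto
  then show ?case using Suc by simp
qed

end

section \<open>From a factorization to an isometry\<close>

lemma norm_le_of_hinner_le:
  assumes p: "p \<in> closure K" and K: "\<And>k. k \<in> K \<Longrightarrow> cmod (hinner k p) \<le> norm k * C" and C: "0 \<le> C"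
  shows "norm (p::'a::complex_inner) \<le> C"
proof -
  obtain k where k: "\<And>i. k i \<in> K" and kp: "k \<longlonglongrightarrow> p"
    using p unfolding closure_sequential by blast
  \<comment> \<open>The bound is available on \<open>K\<close> only; it passes to \<open>p\<close>
    paired with itself along \<open>k i\<close> tending to \<open>p\<close>.\<close>
  have "cmod (hinner p p) \<le> norm p * C"
  proof (rule tendsto_le[OF sequentially_bot])
    show "(\<lambda>i. norm (k i) * C) \<longlonglongrightarrow> norm p * C" by (intro tendsto_intros kp)
    show "(\<lambda>i. cmod (hinner (k i) p)) \<longlonglongrightarrow> cmod (hinner p p)"
      by (intro tendsto_norm tendsto_hinner kp tendsto_const)
  qed (use K k in auto)
  then have "norm p * norm p \<le> norm p * C" by (simp add: hinner_self power2_eq_square norm_mult)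
  then show ?thesis using C by (cases "p = 0") auto
qed

lemma closure_subset_orth_compl_twice: "closure K \<subseteq> orth_compl (orth_compl K)"
proof (rule closure_minimal[OF _ closed_orth_compl])
  show "K \<subseteq> orth_compl (orth_compl K)"
    by (auto simp: orth_compl_def hinner_eq_0_commute)
qed

text \<open>The energy balance turns contractivity of multiplication by \<open>g\<close> into a contraction
  \<open>Vs2\<^sup>t u2\<^sub>j \<mapsto> Vs1\<^sup>t u1\<^sub>j\<close>; the isometry of the theorem is its adjoint.\<close>

lemma op_le_if_transfer_factors:
  fixes u1 v1 :: "'n::finite \<Rightarrow> 'a::chilbert" and u2 v2 :: "'n \<Rightarrow> 'b::chilbert"
  assumes cp1: "cayley_pair V1 Vs1 u1 v1" and cp2: "cayley_pair V2 Vs2 u2 v2"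
    and link1: "\<And>f. f \<in> D1 \<Longrightarrow> V1 (T1 f + hscale \<i> f) = T1 f - hscale \<i> f"
    and link2: "\<And>f. f \<in> D2 \<Longrightarrow> V2 (T2 f + hscale \<i> f) = T2 f - hscale \<i> f"
    and ran2: "\<And>g. (\<And>j. hinner g (u2 j) = 0) \<Longrightarrow> \<exists>f\<in>D2. g = T2 f + hscale \<i> f"
    and ort1: "\<And>f j. f \<in> D1 \<Longrightarrow> hinner (T1 f + hscale \<i> f) (u1 j) = 0"
    and V1_0: "\<And>h. (\<lambda>m. (V1 ^^ m) h) \<longlonglongrightarrow> 0"
    and fac: "\<And>j k. cayley_pair.transfer Vs2 u2 v2 j k
        = (\<Sum>l\<in>UNIV. cayley_pair.transfer Vs1 u1 v1 j l * g l k)"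
    and g: "\<And>y N. (\<Sum>t<N. \<Sum>k\<in>UNIV. (cmod (fps_nth (\<Sum>l\<in>UNIV. y l * g l k) t))\<^sup>2)
        \<le> (\<Sum>t<N. \<Sum>l\<in>UNIV. (cmod (fps_nth (y l) t))\<^sup>2)"
  shows "op_le D1 T1 D2 T2"
proof -
  interpret c1: cayley_pair V1 Vs1 u1 v1 by (rule cp1)
  interpret c2: cayley_pair V2 Vs2 u2 v2 by (rule cp2)
  \<comment> \<open>Both systems receive the same input. The output of the second is that of the
    first multiplied by \<open>g\<close>, so it carries no more energy, and at least as much remains
    in its state.\<close>
  have contr: "norm (c1.state d t) \<le> norm (c2.state d t)" for d t
  proof (rule power2_le_imp_le)
    have "(\<Sum>j\<in>UNIV. d j * c2.transfer j k) = (\<Sum>l\<in>UNIV. (\<Sum>j\<in>UNIV. d j * c1.transfer j l) * g l k)" for k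
      unfolding fac sum_distrib_left sum_distrib_right mult.assoc by (rule sum.swap)
    then show "(norm (c1.state d t))\<^sup>2 \<le> (norm (c2.state d t))\<^sup>2"
      unfolding c1.state_energy c2.state_energy
      using g[of "\<lambda>l. \<Sum>j\<in>UNIV. d j * c1.transfer j l" t] by simp
  qed simp
  define K where "K = {c2.state d t | d t. True}"
  have "\<exists>p\<in>closure K. \<forall>d t. hinner (c2.state d t) p = hinner (c1.state d t) h" for h
  proof -
    \<comment> \<open>Graph of the functional sending a reachable state of the second system to the
      product of the corresponding first state with \<open>h\<close>. Its representer will be
      \<open>W h\<close>.\<close>
    define R where "R = {(c2.state d t, hinner (c1.state d t) h) | d t. True}"
    have K: "fst ` R = K" by (force simp: R_def K_def)
    have "\<exists>p\<in>closure (fst ` R). \<forall>(k, c)\<in>R. hinner k p = c"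
    proof (rule riesz_closure[where C = "norm h"])
      show "(0, 0) \<in> R" unfolding R_def by (auto intro!: exI[of _ 0] simp: c1.state.simps c2.state.simps)
    next
      fix k c k' c' assume "(k, c) \<in> R" "(k', c') \<in> R"
      then obtain d t d' t' where *: "k = c2.state d t" "c = hinner (c1.state d t) h"
        "k' = c2.state d' t'" "c' = hinner (c1.state d' t') h"
        by (auto simp: R_def)
      \<comment> \<open>Each input is delayed by the running time of the other, so both states are
        reached at time t + t'.\<close>
      define e where "e j = fps_X ^ t' * d j + fps_X ^ t * d' j" for j
      have "c2.state e (t + t') = k + k'"
        unfolding e_def c2.state_add * using c2.state_delay[of t' d t] c2.state_delay[of t d' t'] by (simp add: add.commute)
      moreover have "hinner (c1.state e (t + t')) h = c + c'"
        unfolding e_def c1.state_add * using c1.state_delay[of t' d t] c1.state_delay[of t d' t']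
        by (simp add: add.commute hinner_add_left)
      moreover have "(c2.state e (t + t'), hinner (c1.state e (t + t')) h) \<in> R" unfolding R_def by blast
      ultimately show "(k + k', c + c') \<in> R" by simp
    next
      fix k c a assume "(k, c) \<in> R"
      then obtain d t where *: "k = c2.state d t" "c = hinner (c1.state d t) h" by (auto simp: R_def)
      have "hscale a k = c2.state (\<lambda>j. fps_const a * d j) t" "a * c = hinner (c1.state (\<lambda>j. fps_const a * d j) t) h"
        by (simp_all add: * c1.state_scale c2.state_scale hinner_hscale_left)
      then show "(hscale a k, a * c) \<in> R" unfolding R_def by blast
    next
      fix k c assume "(k, c) \<in> R"
      then obtain d t where *: "k = c2.state d t" "c = hinner (c1.state d t) h" by (auto simp: R_def)
      have "cmod c \<le> norm (c1.state d t) * norm h" unfolding * by (rule norm_hinner_le)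
      also have "\<dots> \<le> norm k * norm h" unfolding * by (intro mult_right_mono contr) simp
      finally show "cmod c \<le> norm h * norm k" by (simp add: mult.commute)
    qed
    then obtain p where p: "p \<in> closure K" "\<forall>(k, c)\<in>R. hinner k p = c" unfolding K by blast
    have "(c2.state d t, hinner (c1.state d t) h) \<in> R" for d t unfolding R_def by blast
    then have "hinner (c2.state d t) p = hinner (c1.state d t) h" for d t using p(2) by fast
    with p(1) show ?thesis by blast
  qed
  then obtain W where WK: "\<And>h. W h \<in> closure K"
    and W: "\<And>h d t. hinner (c2.state d t) (W h) = hinner (c1.state d t) h"
    by metis
  \<comment> \<open>The double complement is a subspace containing all \<open>W h\<close>, and its
    elements are determined by their products with reachable states.\<close>
  define M where "M = orth_compl (orth_compl K)"
  have M: "csubspace M" by (simp add: M_def csubspace_orth_compl)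
  have WM: "W h \<in> M" for h using WK closure_subset_orth_compl_twice unfolding M_def by blast
  have orth: "hinner p x = 0" if "p \<in> M" "\<And>d t. hinner (c2.state d t) x = 0" for p x
  proof -
    have "x \<in> orth_compl K" using that(2) by (auto simp: orth_compl_def K_def hinner_eq_0_commute[of x])
    then show ?thesis using that(1) by (simp add: M_def orth_compl_def)
  qed
  have uniq: "p = q" if "p \<in> M" "q \<in> M" "\<And>d t. hinner (c2.state d t) p = hinner (c2.state d t) q" for p q
  proof -
    have "hinner (p - q) (p - q) = 0"
      using csubspaceD(4)[OF M that(1,2)] by (rule orth) (simp add: hinner_diff_right that(3))
    then show ?thesis by simp
  qed
  have W_add: "W (x + y) = W x + W y" for x y
    by (rule uniq[OF WM csubspaceD(2)[OF M WM WM]]) (simp add: hinner_add_right W)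
  have W_scale: "W (hscale c x) = hscale c (W x)" for c x
    by (rule uniq[OF WM csubspaceD(3)[OF M WM]]) (simp add: hinner_hscale_right W)
  have impulse: "hinner ((Vs2 ^^ t) (u2 j)) (W h) = hinner ((Vs1 ^^ t) (u1 j)) h" for t j h
    using W[of "\<lambda>i. if i = j then 1 else 0" "Suc t"] unfolding c1.state_impulse c2.state_impulse .
  have norm_W: "norm (W h) = norm h" for h
  proof (rule antisym)
    show "norm (W h) \<le> norm h"
    proof (rule norm_le_of_hinner_le[OF WK])
      fix k assume "k \<in> K"
      then obtain d t where k: "k = c2.state d t" by (auto simp: K_def)
      have "cmod (hinner (c1.state d t) h) \<le> norm (c1.state d t) * norm h" by (rule norm_hinner_le)
      also have "\<dots> \<le> norm (c2.state d t) * norm h" by (intro mult_right_mono contr) simp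
      finally show "cmod (hinner k (W h)) \<le> norm k * norm h" unfolding k W .
    qed simp
    \<comment> \<open>By \<open>impulse\<close>, \<open>W h\<close> and \<open>h\<close> emit the
      same energy through \<open>u2\<close> and \<open>u1\<close> at every time.\<close>
    have eq: "cmod (hinner ((V2 ^^ t) (W h)) (u2 j)) = cmod (hinner ((V1 ^^ t) h) (u1 j))" for t j
    proof -
      have "hinner ((V2 ^^ t) (W h)) (u2 j) = cnj (hinner ((Vs2 ^^ t) (u2 j)) (W h))"
        unfolding c2.adj_pow by (rule hinner_commute)
      also have "\<dots> = hinner ((V1 ^^ t) h) (u1 j)"
        unfolding impulse c1.adj_pow by (rule hinner_commute[symmetric])
      finally show ?thesis by simp
    qed
    \<comment> \<open>The left side is the energy emitted by \<open>h\<close> up to time m;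
      \<open>W h\<close> emits the same amount, which cannot exceed its own energy. Letting m grow,
      V1^m h -> 0 yields the full norm of \<open>h\<close>.\<close>
    have le: "(norm h)\<^sup>2 - (norm ((V1 ^^ m) h))\<^sup>2 \<le> (norm (W h))\<^sup>2" for m
      using c1.V_pow_energy[of m h] c2.V_pow_energy[of m "W h"] zero_le_power2[of "norm ((V2 ^^ m) (W h))"]
      unfolding eq by linarith
    have "(norm h)\<^sup>2 - (norm (0::'a))\<^sup>2 \<le> (norm (W h))\<^sup>2"
    proof (rule LIMSEQ_le_const2)
      show "(\<lambda>m. (norm h)\<^sup>2 - (norm ((V1 ^^ m) h))\<^sup>2) \<longlonglongrightarrow> (norm h)\<^sup>2 - (norm (0::'a))\<^sup>2"
        by (intro tendsto_diff tendsto_const tendsto_power tendsto_norm V1_0)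
    qed (intro exI allI impI le)
    then have "(norm h)\<^sup>2 \<le> (norm (W h))\<^sup>2" by simp
    then show "norm h \<le> norm (W h)" by (rule power2_le_imp_le) simp
  qed
  have W_u2: "hinner (W h) (u2 j) = 0" if "\<And>j. hinner h (u1 j) = 0" for h j
    using impulse[of 0 j h] that[of j] by (simp add: hinner_eq_0_commute[of "W h"] hinner_eq_0_commute[of h])
  have W_V: "V2 (W h) = W (V1 h)" if h: "\<And>j. hinner h (u1 j) = 0" for h
  proof -
    \<comment> \<open>For \<open>h\<close> orthogonal to the \<open>u1 j\<close> the last input does
      not contribute, so the step from time t to t + 1 moves V1 and V2 across.\<close>
    have "hinner (c2.state d t) (V2 (W h) - W (V1 h)) = 0" for d t
    proof -
      have u: "hinner (u2 j) (W h) = 0" "hinner (u1 j) h = 0" for j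
        using W_u2[OF h] h by (simp_all add: hinner_eq_0_commute[of "u2 j"] hinner_eq_0_commute[of "u1 j"])
      have "hinner (c2.state d t) (V2 (W h)) = hinner (c2.state d (Suc t)) (W h)"
        by (simp add: c2.swap.adj hinner_add_left hinner_sum_left hinner_hscale_left u)
      also have "\<dots> = hinner (c1.state d t) (V1 h)"
        unfolding W by (simp add: c1.swap.adj hinner_add_left hinner_sum_left hinner_hscale_left u)
      finally show ?thesis by (simp add: hinner_diff_right W)
    qed
    then have o: "hinner (W (V1 h)) (V2 (W h) - W (V1 h)) = 0" by (rule orth[OF WM])
    \<comment> \<open>Pythagoras against equality of norms: V1 is isometric at \<open>h\<close>, V2
      at \<open>W h\<close>, and W everywhere, so the difference vanishes.\<close>
    have "(norm (V2 (W h)))\<^sup>2 = (norm (W (V1 h)))\<^sup>2 + (norm (V2 (W h) - W (V1 h)))\<^sup>2"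
      using norm_add_sq[of "W (V1 h)" "V2 (W h) - W (V1 h)"] o by simp
    moreover have "(norm (V2 (W h)))\<^sup>2 = (norm (W (V1 h)))\<^sup>2"
      unfolding c2.norm_V_sq norm_W c1.norm_V_sq using h W_u2[OF h] by simp
    ultimately show ?thesis by simp
  qed
  have main: "W f \<in> D2 \<and> T2 (W f) = W (T1 f)" if f: "f \<in> D1" for f
  proof -
    define h where "h = T1 f + hscale \<i> f"
    have h: "hinner h (u1 j) = 0" for j using ort1[OF f] by (simp add: h_def)
    obtain f' where f': "f' \<in> D2" "W h = T2 f' + hscale \<i> f'" using ran2[OF W_u2[OF h]] by blast
    \<comment> \<open>\<open>W\<close> sends T1 f + i f to T2 f' + i f' and T1 f - i f to T2 f' - i
      f'; sum and difference recover \<open>T2 f'\<close> and \<open>f'\<close>.\<close>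
    have minus: "W (T1 f - hscale \<i> f) = T2 f' - hscale \<i> f'"
      using W_V[OF h] unfolding f'(2) link2[OF f'(1)] by (simp add: h_def link1[OF f])
    have sum_diff_eq: "a + a = (a - b) + (a + b)" "b + b = (a + b) - (a - b)" for a b :: 'b by simp_all
    have "W (T1 f) - hscale \<i> (W f) = T2 f' - hscale \<i> f'"
      using minus W_add[of "T1 f" "hscale (- \<i>) f"] W_scale[of "- \<i>" f] by simp
    moreover have "W (T1 f) + hscale \<i> (W f) = T2 f' + hscale \<i> f'"
      using f'(2) by (simp add: h_def W_add W_scale)
    ultimately have eqs: "W (T1 f) + W (T1 f) = T2 f' + T2 f'" "hscale \<i> (W f) + hscale \<i> (W f) = hscale \<i> f' + hscale \<i> f'"
      by (metis sum_diff_eq(1), metis sum_diff_eq(2))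
    have half: "x = y" if "x + x = y + y" for x y :: 'b
    proof -
      have "(2::real) *\<^sub>R x = 2 *\<^sub>R y" using that by (simp add: scaleR_2)
      then show ?thesis by simp
    qed
    have "hscale \<i> (W f) = hscale \<i> f'" by (rule half[OF eqs(2)])
    then have "hscale (- \<i>) (hscale \<i> (W f)) = hscale (- \<i>) (hscale \<i> f')" by simp
    then have "W f = f'" by (simp add: hscale_hscale hscale_one del: hscale_minus_left)
    with half[OF eqs(1)] f'(1) show ?thesis by simp
  qed
  show ?thesis unfolding op_le_def
  proof (intro exI[of _ W] conjI)
    show "isometry W" by (simp add: isometry_def clinear_on_def W_add W_scale norm_W)
  qed (use main in auto)
qed

section \<open>Parseval on the real line\<close>

text \<open>This parametrizes the unit circle without 1 by the real line, where the boundary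
  condition of \<open>inner_fn\<close> is stated.\<close>

definition beta :: "real \<Rightarrow> complex" where
  "beta x = bfac (of_real x)"

text \<open>The image of this measure under \<open>beta\<close> is normalized arc length on the unit circle.\<close>

definition cayley_measure :: "real measure" where
  "cayley_measure = density lborel (\<lambda>x. ennreal (1 / (pi * (1 + x\<^sup>2))))"

lemma of_real_plus_ii_nz: "complex_of_real x + \<i> \<noteq> 0"
  by (simp add: complex_eq_iff)

lemma norm_beta: "cmod (beta x) = 1"
proof -
  have "cmod (of_real x - \<i>) = cmod (of_real x + \<i>)" by (simp add: cmod_def)
  then show ?thesis using of_real_plus_ii_nz[of x] by (simp add: beta_def bfac_def norm_divide)
qed

lemma cnj_beta: "cnj (beta x) = inverse (beta x)"
  by (simp add: beta_def bfac_def)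

lemma beta_nz: "beta x \<noteq> 0"
  using norm_beta[of x] by auto

lemma continuous_on_beta: "continuous_on UNIV beta"
  unfolding beta_def bfac_def by (intro continuous_intros) (simp add: of_real_plus_ii_nz)

lemma borel_measurable_beta [measurable]: "beta \<in> borel_measurable borel"
  using continuous_on_beta by (rule borel_measurable_continuous_onI)

lemma borel_measurable_cnj_beta [measurable]: "(\<lambda>x. cnj (beta x)) \<in> borel_measurable borel"
  unfolding cnj_beta by measurable

lemma one_plus_sq_pos: "0 < 1 + (x::real)\<^sup>2"
  by (simp add: add_pos_nonneg)

lemma Cauchy_kernel_integral:
  "integrable lborel (\<lambda>x::real. 1 / (1 + x\<^sup>2))" "(\<integral>x. 1 / (1 + x\<^sup>2) \<partial>lborel) = pi"
proof -
  have nz: "1 + x\<^sup>2 \<noteq> 0" for x :: real using one_plus_sq_pos[of x] by linarith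
  have D: "DERIV arctan x :> 1 / (1 + x\<^sup>2)" for x
    using DERIV_arctan[of x] by (simp add: inverse_eq_divide)
  have C: "isCont (\<lambda>x::real. 1 / (1 + x\<^sup>2)) x" for x by (intro continuous_intros nz)
  have A: "((arctan \<circ> real_of_ereal) \<longlongrightarrow> - (pi / 2)) (at_right (-\<infinity>))"
    "((arctan \<circ> real_of_ereal) \<longlongrightarrow> pi / 2) (at_left \<infinity>)"
    unfolding ereal_tendsto_simps by (rule tendsto_arctan_at_bot, rule tendsto_arctan_at_top)
  note F = interval_integral_FTC_nonneg[of "-\<infinity>" \<infinity>, OF _ D C _ A]
  have "set_integrable lborel (einterval (-\<infinity>) \<infinity>) (\<lambda>x::real. 1 / (1 + x\<^sup>2))"
    by (rule F(1)) (auto intro!: AE_I2)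
  then show "integrable lborel (\<lambda>x::real. 1 / (1 + x\<^sup>2))" by (simp add: set_integrable_def)
  have "(LBINT x=-\<infinity>..\<infinity>. 1 / (1 + x\<^sup>2)) = pi / 2 - - (pi / 2)"
    by (rule F(2)) (auto intro!: AE_I2)
  then show "(\<integral>x. 1 / (1 + x\<^sup>2) \<partial>lborel) = pi"
    by (simp add: interval_lebesgue_integral_def set_lebesgue_integral_def)
qed

lemma sets_cayley_measure [simp, measurable_cong]: "sets cayley_measure = sets borel"
  and space_cayley_measure [simp]: "space cayley_measure = UNIV"
  by (simp_all add: cayley_measure_def)

lemma integral_cayley_measure:
  fixes f :: "real \<Rightarrow> 'a::{banach, second_countable_topology}"
  assumes "f \<in> borel_measurable borel"
  shows "integral\<^sup>L cayley_measure f = (\<integral>x. (1 / (pi * (1 + x\<^sup>2))) *\<^sub>R f x \<partial>lborel)"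
  unfolding cayley_measure_def
  by (rule integral_density) (use assms one_plus_sq_pos in \<open>auto intro!: AE_I2 simp: less_imp_le\<close>)

lemma prob_cayley_measure: "emeasure cayley_measure UNIV = 1"
proof -
  have "emeasure cayley_measure UNIV = (\<integral>\<^sup>+x. ennreal (1 / (pi * (1 + x\<^sup>2))) \<partial>lborel)"
    by (simp add: cayley_measure_def emeasure_density)
  also have "\<dots> = ennreal (\<integral>x. 1 / (pi * (1 + x\<^sup>2)) \<partial>lborel)"
  proof (rule nn_integral_eq_integral)
    show "integrable lborel (\<lambda>x. 1 / (pi * (1 + x\<^sup>2)))"
      using integrable_mult_left[OF Cauchy_kernel_integral(1), of "1 / pi"] by (simp add: mult.commute)
  qed (use one_plus_sq_pos in \<open>auto intro!: AE_I2 simp: less_imp_le\<close>)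
  also have "(\<integral>x. 1 / (pi * (1 + x\<^sup>2)) \<partial>lborel) = (\<integral>x. (1 / pi) * (1 / (1 + x\<^sup>2)) \<partial>lborel)"
    by simp
  also have "\<dots> = 1"
    unfolding integral_mult_right_zero Cauchy_kernel_integral(2) by simp
  finally show ?thesis by simp
qed

interpretation cayley_measure: finite_measure cayley_measure
  by standard (simp add: prob_cayley_measure)

lemma tendsto_beta:
  "(beta \<longlongrightarrow> 1) at_top" "(beta \<longlongrightarrow> 1) at_bot"
proof -
  have e: "beta x = 1 - 2 * \<i> / (of_real x + \<i>)" for x
    using of_real_plus_ii_nz[of x] by (simp add: beta_def bfac_def field_simps)
  have b: "cmod (2 * \<i> / (of_real x + \<i>)) \<le> 2 * inverse \<bar>x\<bar>" if "x \<noteq> 0" for x :: real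
  proof -
    have "\<bar>x\<bar> \<le> cmod (of_real x + \<i>)" using abs_Re_le_cmod[of "of_real x + \<i>"] by simp
    then show ?thesis using that by (simp add: norm_divide norm_mult divide_simps)
  qed
  have 0: "((\<lambda>x. 2 * \<i> / (complex_of_real x + \<i>)) \<longlongrightarrow> 0) F"
    if "filterlim (\<lambda>x. \<bar>x\<bar>) at_top F" "eventually (\<lambda>x. x \<noteq> 0) F" for F
  proof (rule Lim_null_comparison)
    show "eventually (\<lambda>x. cmod (2 * \<i> / (of_real x + \<i>)) \<le> 2 * inverse \<bar>x\<bar>) F"
      using that(2) by eventually_elim (rule b)
    show "((\<lambda>x. 2 * inverse \<bar>x\<bar>) \<longlongrightarrow> 0) F"
      using that(1) by (intro tendsto_mult_right_zero tendsto_inverse_0_at_top)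
  qed
  have "((\<lambda>x. 1 - 2 * \<i> / (complex_of_real x + \<i>)) \<longlongrightarrow> 1 - 0) at_top"
    by (intro tendsto_diff tendsto_const 0 filterlim_abs_real eventually_at_top_not_equal) 
  then show "(beta \<longlongrightarrow> 1) at_top" unfolding e[abs_def] by simp
  have "((\<lambda>x. 1 - 2 * \<i> / (complex_of_real x + \<i>)) \<longlongrightarrow> 1 - 0) at_bot"
  proof (intro tendsto_diff tendsto_const 0)
    show "filterlim (\<lambda>x::real. \<bar>x\<bar>) at_top at_bot"
      using filterlim_compose[OF filterlim_abs_real filterlim_uminus_at_top_at_bot] by simp
    show "eventually (\<lambda>x::real. x \<noteq> 0) at_bot" by (rule eventually_at_bot_not_equal)
  qed
  then show "(beta \<longlongrightarrow> 1) at_bot" unfolding e[abs_def] by simp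
qed

text \<open>The derivative of beta is 2i beta / (1 + x^2), so beta^k / (2ik) is an antiderivative up
  to the factor pi; it has the same limit at both ends of the line, where beta tends to 1.\<close>

lemma integral_beta_power:
  assumes "0 < k"
  shows "(\<integral>x. beta x ^ k \<partial>cayley_measure) = 0"
proof -
  let ?f = "\<lambda>x. (1 / (1 + x\<^sup>2)) *\<^sub>R beta x ^ k"
  have "((\<lambda>x. beta x ^ k) has_vector_derivative (2 * \<i> * of_nat k * ?f x)) (at x)" for x
  proof -
    have nz: "complex_of_real x + \<i> \<noteq> 0" "complex_of_real x - \<i> \<noteq> 0" by (simp_all add: complex_eq_iff)
    have "((\<lambda>z. bfac z ^ k) has_field_derivative (of_nat k * bfac (of_real x) ^ (k - 1) * (2 * \<i> / (of_real x + \<i>)\<^sup>2)))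
        (at (of_real x))"
      unfolding bfac_def
      by (rule derivative_eq_intros refl nz | simp)+ (use nz in \<open>simp add: field_simps power2_eq_square\<close>)
    then have "((\<lambda>x. bfac (of_real x) ^ k) has_vector_derivative
        (of_nat k * bfac (of_real x) ^ (k - 1) * (2 * \<i> / (of_real x + \<i>)\<^sup>2))) (at x)"
      by (rule has_vector_derivative_real_field)
    moreover have "of_nat k * bfac (of_real x) ^ (k - 1) * (2 * \<i> / (of_real x + \<i>)\<^sup>2) = 2 * \<i> * of_nat k * ?f x"
    proof -
      have "1 + (complex_of_real x)\<^sup>2 = (of_real x + \<i>) * (of_real x - \<i>)"
        by (simp add: algebra_simps power2_eq_square)
      then have "bfac (of_real x) / (1 + (complex_of_real x)\<^sup>2) = 1 / (of_real x + \<i>)\<^sup>2"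
        using nz by (simp add: bfac_def power2_eq_square divide_simps)
      moreover have "bfac (of_real x) ^ k = bfac (of_real x) ^ (k - 1) * bfac (of_real x)"
        using assms by (metis power_minus_mult)
      ultimately show ?thesis by (simp add: beta_def scaleR_conv_of_real) (metis mult.assoc mult.left_commute times_divide_eq_right mult_1_right)
    qed
    ultimately show ?thesis by (simp add: beta_def)
  qed
  then have D: "((\<lambda>x. beta x ^ k / (2 * \<i> * of_nat k)) has_vector_derivative ?f x) (at x)" for x
    using assms has_vector_derivative_divide[of "\<lambda>x. beta x ^ k" "2 * \<i> * of_nat k * ?f x" "at x" "2 * \<i> * of_nat k"]
    by (simp add: scaleR_conv_of_real)
  have C: "isCont ?f x" for x
  proof -
    have "continuous_on UNIV ?f"
      using one_plus_sq_pos by (intro continuous_intros continuous_on_beta) (metis less_irrefl)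
    then show ?thesis by (simp add: continuous_on_eq_continuous_at)
  qed
  have int: "integrable lborel ?f"
  proof (rule Bochner_Integration.integrable_bound[OF Cauchy_kernel_integral(1)])
    show "?f \<in> borel_measurable lborel" by measurable
  qed (auto intro!: AE_I2 simp: norm_power norm_beta)
  have lim: "(((\<lambda>x. beta x ^ k / (2 * \<i> * of_nat k)) \<circ> real_of_ereal) \<longlongrightarrow> 1 / (2 * \<i> * of_nat k)) (at_right (-\<infinity>))"
    "(((\<lambda>x. beta x ^ k / (2 * \<i> * of_nat k)) \<circ> real_of_ereal) \<longlongrightarrow> 1 / (2 * \<i> * of_nat k)) (at_left \<infinity>)"
    unfolding ereal_tendsto_simps using assms
    by (auto intro!: tendsto_eq_intros tendsto_beta)
  have "(LBINT x=-\<infinity>..\<infinity>. ?f x) = 1 / (2 * \<i> * of_nat k) - 1 / (2 * \<i> * of_nat k)"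
    by (rule interval_integral_FTC_integrable[OF _ D C _ lim]) (use int in \<open>auto simp: set_integrable_def\<close>)
  then have "(\<integral>x. ?f x \<partial>lborel) = 0"
    by (simp add: interval_lebesgue_integral_def set_lebesgue_integral_def)
  then have "(\<integral>x. (1 / pi) *\<^sub>R ?f x \<partial>lborel) = 0" by (simp only: integral_scaleR_right scaleR_zero_right)
  moreover have "(\<integral>x. beta x ^ k \<partial>cayley_measure) = (\<integral>x. (1 / pi) *\<^sub>R ?f x \<partial>lborel)"
    by (subst integral_cayley_measure) (auto intro!: Bochner_Integration.integral_cong)
  ultimately show ?thesis by simp
qed

lemma integrable_cayley_bounded:
  fixes f :: "real \<Rightarrow> 'a::{banach, second_countable_topology}"
  assumes "f \<in> borel_measurable borel" "\<And>x. norm (f x) \<le> C"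
  shows "integrable cayley_measure f"
  by (rule cayley_measure.integrable_const_bound[where B = C]) (use assms in \<open>auto intro!: AE_I2\<close>)

lemma integral_beta_cnj_beta:
  "(\<integral>x. beta x ^ s * cnj (beta x) ^ t \<partial>cayley_measure) = (if s = t then 1 else 0)"
proof -
  have less: "(\<integral>x. beta x ^ s * cnj (beta x) ^ t \<partial>cayley_measure) = 0" if "t < s" for s t
  proof -
    have "beta x ^ s * cnj (beta x) ^ t = beta x ^ (s - t)" for x
      using that beta_nz[of x] by (simp add: cnj_beta power_diff field_simps)
    then show ?thesis using integral_beta_power[of "s - t"] that by simp
  qed
  consider "s = t" | "t < s" | "s < t" by linarith
  then show ?thesis
  proof cases
    case 1
    then have "beta x ^ s * cnj (beta x) ^ t = 1" for x
      using beta_nz[of x] by (simp add: cnj_beta field_simps)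
    then show ?thesis using 1 prob_cayley_measure by (simp add: measure_def)
  next
    case 3
    have "(\<integral>x. beta x ^ s * cnj (beta x) ^ t \<partial>cayley_measure) = (\<integral>x. cnj (beta x ^ t * cnj (beta x) ^ s) \<partial>cayley_measure)"
      by (simp add: mult.commute)
    also have "\<dots> = cnj (\<integral>x. beta x ^ t * cnj (beta x) ^ s \<partial>cayley_measure)" by (rule Bochner_Integration.integral_cnj)
    finally show ?thesis using less[OF 3] 3 by simp
  qed (use less in auto)
qed

lemma parseval_polynomial:
  "(\<integral>x. (cmod (\<Sum>t<N. c t * beta x ^ t))\<^sup>2 \<partial>cayley_measure) = (\<Sum>t<N. (cmod (c t))\<^sup>2)"
proof -
  have int: "integrable cayley_measure (\<lambda>x. a * (beta x ^ s * cnj (beta x) ^ t))" for a s t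
    by (rule integrable_cayley_bounded[where C = "cmod a"])
      (auto simp: norm_mult norm_power norm_beta)
  have "complex_of_real (\<integral>x. (cmod (\<Sum>t<N. c t * beta x ^ t))\<^sup>2 \<partial>cayley_measure)
      = (\<integral>x. of_real ((cmod (\<Sum>t<N. c t * beta x ^ t))\<^sup>2) \<partial>cayley_measure)"
    by (rule integral_complex_of_real[symmetric])
  also have "\<dots> = (\<integral>x. (\<Sum>s<N. \<Sum>t<N. (c s * cnj (c t)) * (beta x ^ s * cnj (beta x) ^ t)) \<partial>cayley_measure)"
    by (intro Bochner_Integration.integral_cong refl)
      (simp add: complex_norm_square sum_product mult_ac del: of_real_power)
  also have "\<dots> = (\<Sum>s<N. \<Sum>t<N. (c s * cnj (c t)) * (if s = t then 1 else 0))"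
    by (subst Bochner_Integration.integral_sum, intro Bochner_Integration.integrable_sum int)
      (subst Bochner_Integration.integral_sum, rule int,
       simp only: integral_mult_right_zero integral_beta_cnj_beta)
  also have "\<dots> = of_real (\<Sum>t<N. (cmod (c t))\<^sup>2)"
    by (simp add: if_distrib complex_norm_square cong: if_cong del: of_real_power)
  finally show ?thesis by (simp only: of_real_eq_iff)
qed

text \<open>For r < 1 the series converges absolutely on the circle of radius r, so its partial sums
  have a common bound and Parseval for polynomials passes to the limit.\<close>

lemma parseval_fps:
  assumes R: "1 \<le> fps_conv_radius f" and r: "0 \<le> r" "r < 1"
  shows "(\<lambda>t. (cmod (fps_nth f t))\<^sup>2 * r ^ (2 * t)) sums
      (\<integral>x. (cmod (eval_fps f (of_real r * beta x)))\<^sup>2 \<partial>cayley_measure)"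
    and "integrable cayley_measure (\<lambda>x. (cmod (eval_fps f (of_real r * beta x)))\<^sup>2)"
proof -
  define P where "P N x = (\<Sum>t<N. fps_nth f t * of_real r ^ t * beta x ^ t)" for N x
  have nr: "ereal (norm (of_real r * beta x)) < fps_conv_radius f" for x
  proof -
    have "norm (of_real r * beta x) < 1" using r by (simp add: norm_mult norm_beta)
    then show ?thesis using R by (metis ereal_less(3) less_le_trans one_ereal_def)
  qed
  have sums: "(\<lambda>t. fps_nth f t * of_real r ^ t * beta x ^ t) sums eval_fps f (of_real r * beta x)" for x
    using sums_eval_fps[OF nr] by (simp add: power_mult_distrib mult.assoc)
  have absr: "summable (\<lambda>t. cmod (fps_nth f t) * r ^ t)"
    using norm_summable_fps[OF nr[of 0]] r by (simp add: norm_mult norm_power norm_beta)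
  define C where "C = (\<Sum>t. cmod (fps_nth f t) * r ^ t)"
  have PC: "cmod (P N x) \<le> C" for N x
  proof -
    have "cmod (P N x) \<le> (\<Sum>t<N. cmod (fps_nth f t) * r ^ t)"
      unfolding P_def using r by (intro order_trans[OF norm_sum]) (simp add: norm_mult norm_power norm_beta)
    also have "\<dots> \<le> C" unfolding C_def using r by (intro sum_le_suminf absr) auto
    finally show ?thesis .
  qed
  have lim: "(\<lambda>N. P N x) \<longlonglongrightarrow> eval_fps f (of_real r * beta x)" for x
    using sums[of x] by (simp add: sums_def P_def)
  have meas [measurable]: "P N \<in> borel_measurable borel" for N unfolding P_def by measurable
  have [measurable]: "(\<lambda>x. eval_fps f (of_real r * beta x)) \<in> borel_measurable borel"
    by (rule borel_measurable_LIMSEQ_metric[OF meas lim])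
  have C2: "(cmod (P N x))\<^sup>2 \<le> C\<^sup>2" for N x by (intro power_mono PC) simp
  note D = integral_dominated_convergence[where s = "\<lambda>N x. (cmod (P N x))\<^sup>2" and
      f = "\<lambda>x. (cmod (eval_fps f (of_real r * beta x)))\<^sup>2" and M = cayley_measure and w = "\<lambda>_. C\<^sup>2"]
  have "(\<lambda>N. \<integral>x. (cmod (P N x))\<^sup>2 \<partial>cayley_measure) \<longlonglongrightarrow>
      (\<integral>x. (cmod (eval_fps f (of_real r * beta x)))\<^sup>2 \<partial>cayley_measure)"
    by (rule D) (auto intro!: AE_I2 tendsto_intros lim C2 simp: meas)
  moreover have "(\<integral>x. (cmod (P N x))\<^sup>2 \<partial>cayley_measure) = (\<Sum>t<N. (cmod (fps_nth f t))\<^sup>2 * r ^ (2 * t))" for N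
    unfolding P_def parseval_polynomial
    using r by (simp add: norm_mult norm_power power_mult_distrib power_mult mult.commute flip: power_mult)
  ultimately show "(\<lambda>t. (cmod (fps_nth f t))\<^sup>2 * r ^ (2 * t)) sums
      (\<integral>x. (cmod (eval_fps f (of_real r * beta x)))\<^sup>2 \<partial>cayley_measure)"
    by (simp add: sums_def)
  have "(cmod (eval_fps f (of_real r * beta x)))\<^sup>2 \<le> C\<^sup>2" for x
    by (rule LIMSEQ_le_const2[OF tendsto_power[OF tendsto_norm[OF lim]]]) (use C2 in blast)
  then show "integrable cayley_measure (\<lambda>x. (cmod (eval_fps f (of_real r * beta x)))\<^sup>2)"
    by (intro integrable_cayley_bounded[where C = "C\<^sup>2"]) auto
qed

section \<open>Power series on the unit disc and matrix contractions\<close>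

lemma less_fps_conv_radius:
  assumes "1 \<le> fps_conv_radius f" "norm z < 1"
  shows "ereal (norm z) < fps_conv_radius f"
proof -
  have "ereal (norm z) < 1" using assms(2) by (simp add: one_ereal_def)
  then show ?thesis using assms(1) by (rule less_le_trans)
qed

lemma one_le_fps_conv_radius_I:
  fixes f :: "complex fps"
  assumes "\<And>z. cmod z < 1 \<Longrightarrow> summable (\<lambda>t. fps_nth f t * z ^ t)"
  shows "1 \<le> fps_conv_radius f"
  unfolding fps_conv_radius_def
proof (rule conv_radius_geI_ex')
  fix r :: real assume "0 < r" "ereal r < 1"
  then show "summable (\<lambda>t. fps_nth f t * complex_of_real r ^ t)"
    by (intro assms) (simp add: one_ereal_def)
qed

lemma eval_fps_sum_mult:
  fixes f g :: "'i \<Rightarrow> complex fps"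
  assumes "\<And>i. 1 \<le> fps_conv_radius (f i)" "\<And>i. 1 \<le> fps_conv_radius (g i)"
  shows "1 \<le> fps_conv_radius (\<Sum>i\<in>A. f i * g i)"
    and "norm z < 1 \<Longrightarrow> eval_fps (\<Sum>i\<in>A. f i * g i) z = (\<Sum>i\<in>A. eval_fps (f i) z * eval_fps (g i) z)"
proof -
  have m: "1 \<le> fps_conv_radius (f i * g i)" for i
    by (rule order_trans[OF _ fps_conv_radius_mult]) (simp add: assms)
  show R: "1 \<le> fps_conv_radius (\<Sum>i\<in>A. f i * g i)" for A
  proof (induction A rule: infinite_finite_induct)
    case (insert x A)
    have "1 \<le> min (fps_conv_radius (f x * g x)) (fps_conv_radius (\<Sum>i\<in>A. f i * g i))"
      using m insert by simp
    also have "\<dots> \<le> fps_conv_radius (f x * g x + (\<Sum>i\<in>A. f i * g i))" by (rule fps_conv_radius_add)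
    finally show ?case using insert by simp
  qed auto
  assume z: "norm z < 1"
  show "eval_fps (\<Sum>i\<in>A. f i * g i) z = (\<Sum>i\<in>A. eval_fps (f i) z * eval_fps (g i) z)"
  proof (induction A rule: infinite_finite_induct)
    case (insert x A)
    then show ?case
      using z assms by (simp add: eval_fps_add eval_fps_mult less_fps_conv_radius m R)
  qed auto
qed

text \<open>Inputs act as row vectors, while contractivity of \<open>A\<close> concerns columns.
  Testing y = c A with its conjugate x gives |y|^2 = |sum_j c_j (A x)_j| <= |c| |A x| <= |c|
  |y|.\<close>

lemma row_contraction:
  fixes A :: "complex^'n::finite^'n"
  assumes "\<And>x. norm (A *v x) \<le> norm x"
  shows "(\<Sum>k\<in>UNIV. (cmod (\<Sum>j\<in>UNIV. c j * A $ j $ k))\<^sup>2) \<le> (\<Sum>j\<in>UNIV. (cmod (c j))\<^sup>2)"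
proof -
  define y :: "complex^'n" where "y = (\<chi> k. \<Sum>j\<in>UNIV. c j * A $ j $ k)"
  define x :: "complex^'n" where "x = (\<chi> k. cnj (y $ k))"
  have nx: "norm x = norm y" by (simp add: norm_vec_def x_def)
  have "complex_of_real ((norm y)\<^sup>2) = (\<Sum>k\<in>UNIV. y $ k * x $ k)"
    by (simp add: norm_vec_def L2_set_def sum_nonneg x_def complex_norm_square del: of_real_power)
  also have "\<dots> = (\<Sum>k\<in>UNIV. \<Sum>j\<in>UNIV. c j * (A $ j $ k * x $ k))"
    by (simp add: y_def sum_distrib_right mult.assoc)
  also have "\<dots> = (\<Sum>j\<in>UNIV. c j * (A *v x) $ j)"
    by (subst sum.swap) (simp add: matrix_vector_mult_def sum_distrib_left)
  finally have "(norm y)\<^sup>2 = cmod (\<Sum>j\<in>UNIV. c j * (A *v x) $ j)"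
    by (metis abs_of_nonneg norm_of_real zero_le_power2)
  also have "\<dots> \<le> (\<Sum>j\<in>UNIV. \<bar>cmod (c j)\<bar> * \<bar>cmod ((A *v x) $ j)\<bar>)"
    by (intro order_trans[OF norm_sum]) (simp add: norm_mult)
  also have "\<dots> \<le> L2_set (\<lambda>j. cmod (c j)) UNIV * norm (A *v x)"
    unfolding norm_vec_def by (rule L2_set_mult_ineq)
  also have "\<dots> \<le> L2_set (\<lambda>j. cmod (c j)) UNIV * norm y"
    using assms[of x] nx by (intro mult_left_mono) auto
  finally have "norm y * norm y \<le> L2_set (\<lambda>j. cmod (c j)) UNIV * norm y" by (simp add: power2_eq_square)
  then have "norm y \<le> L2_set (\<lambda>j. cmod (c j)) UNIV"
    by (cases "norm y = 0") auto
  then have "(norm y)\<^sup>2 \<le> (L2_set (\<lambda>j. cmod (c j)) UNIV)\<^sup>2" by (intro power_mono) auto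
  then show ?thesis by (simp add: norm_vec_def L2_set_def sum_nonneg y_def)
qed

text \<open>Parseval on the circle of radius r turns the pointwise row contraction into an
  inequality between weighted sums of coefficients, and r -> 1 removes the weights.\<close>

lemma toeplitz_contraction:
  fixes g :: "'n::finite \<Rightarrow> 'n \<Rightarrow> complex fps"
  assumes R: "\<And>l k. 1 \<le> fps_conv_radius (g l k)"
    and contr: "\<And>z x. cmod z < 1 \<Longrightarrow> norm ((\<chi> l k. eval_fps (g l k) z) *v x) \<le> norm x"
  shows "(\<Sum>t<N. \<Sum>k\<in>UNIV. (cmod (fps_nth (\<Sum>l\<in>UNIV. y l * g l k) t))\<^sup>2)
    \<le> (\<Sum>t<N. \<Sum>l\<in>UNIV. (cmod (fps_nth (y l) t))\<^sup>2)"
proof -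
  \<comment> \<open>Causality: the first N output coefficients depend only on the first N input
    coefficients, so polynomial inputs suffice.\<close>
  define p where "p l = fps_cutoff N (y l)" for l
  have Rp: "1 \<le> fps_conv_radius (p l)" for l
    by (intro one_le_fps_conv_radius_I summable_finite[of "{..<N}"]) (auto simp: p_def)
  define q where "q k = (\<Sum>l\<in>UNIV. p l * g l k)" for k
  have Rq: "1 \<le> fps_conv_radius (q k)" for k unfolding q_def by (rule eval_fps_sum_mult(1)[OF Rp R])
  have qy: "fps_nth (\<Sum>l\<in>UNIV. y l * g l k) t = fps_nth (q k) t" if "t < N" for t k
    unfolding q_def fps_sum_nth fps_mult_nth using that by (intro sum.cong) (auto simp: p_def)
  have le: "(\<Sum>t<N. \<Sum>k\<in>UNIV. (cmod (fps_nth (q k) t))\<^sup>2 * r ^ (2 * t)) \<le> (\<Sum>t<N. \<Sum>l\<in>UNIV. (cmod (fps_nth (y l) t))\<^sup>2)"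
    if r: "0 \<le> r" "r < 1" for r :: real
  proof -
    have nr: "cmod (of_real r * beta x) < 1" for x using r by (simp add: norm_mult norm_beta)
    have "(\<Sum>t<N. \<Sum>k\<in>UNIV. (cmod (fps_nth (q k) t))\<^sup>2 * r ^ (2 * t))
        = (\<Sum>k\<in>UNIV. \<Sum>t<N. (cmod (fps_nth (q k) t))\<^sup>2 * r ^ (2 * t))" by (rule sum.swap)
    also have "\<dots> \<le> (\<Sum>k\<in>UNIV. \<integral>x. (cmod (eval_fps (q k) (of_real r * beta x)))\<^sup>2 \<partial>cayley_measure)"
    proof (rule sum_mono)
      fix k
      note s = parseval_fps(1)[OF Rq r, of k]
      show "(\<Sum>t<N. (cmod (fps_nth (q k) t))\<^sup>2 * r ^ (2 * t))
          \<le> (\<integral>x. (cmod (eval_fps (q k) (of_real r * beta x)))\<^sup>2 \<partial>cayley_measure)"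
        unfolding sums_unique[OF s] using r by (intro sum_le_suminf sums_summable[OF s]) auto
    qed
    also have "\<dots> = (\<integral>x. (\<Sum>k\<in>UNIV. (cmod (eval_fps (q k) (of_real r * beta x)))\<^sup>2) \<partial>cayley_measure)"
      by (rule Bochner_Integration.integral_sum[symmetric]) (rule parseval_fps(2)[OF Rq r])
    also have "\<dots> \<le> (\<integral>x. (\<Sum>l\<in>UNIV. (cmod (eval_fps (p l) (of_real r * beta x)))\<^sup>2) \<partial>cayley_measure)"
    proof (rule integral_mono)
      fix x
      show "(\<Sum>k\<in>UNIV. (cmod (eval_fps (q k) (of_real r * beta x)))\<^sup>2) \<le> (\<Sum>l\<in>UNIV. (cmod (eval_fps (p l) (of_real r * beta x)))\<^sup>2)"
        using row_contraction[OF contr[OF nr], of "\<lambda>l. eval_fps (p l) (of_real r * beta x)" x]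
        by (simp add: q_def eval_fps_sum_mult(2)[OF Rp R nr])
    qed (intro Bochner_Integration.integrable_sum parseval_fps(2)[OF _ r] Rq Rp)+
    also have "\<dots> = (\<Sum>l\<in>UNIV. \<integral>x. (cmod (eval_fps (p l) (of_real r * beta x)))\<^sup>2 \<partial>cayley_measure)"
      by (rule Bochner_Integration.integral_sum) (rule parseval_fps(2)[OF Rp r])
    also have "\<dots> = (\<Sum>l\<in>UNIV. \<Sum>t<N. (cmod (fps_nth (y l) t))\<^sup>2 * r ^ (2 * t))"
    proof (rule sum.cong[OF refl])
      fix l
      have "(\<lambda>t. (cmod (fps_nth (p l) t))\<^sup>2 * r ^ (2 * t)) sums (\<Sum>t<N. (cmod (fps_nth (p l) t))\<^sup>2 * r ^ (2 * t))"
        by (rule sums_finite) (auto simp: p_def)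
      from sums_unique2[OF parseval_fps(1)[OF Rp r, of l] this]
      show "(\<integral>x. (cmod (eval_fps (p l) (of_real r * beta x)))\<^sup>2 \<partial>cayley_measure) = (\<Sum>t<N. (cmod (fps_nth (y l) t))\<^sup>2 * r ^ (2 * t))"
        by (simp add: p_def)
    qed
    also have "\<dots> \<le> (\<Sum>l\<in>UNIV. \<Sum>t<N. (cmod (fps_nth (y l) t))\<^sup>2)"
      using r by (intro sum_mono mult_left_le power_le_one) auto
    also have "\<dots> = (\<Sum>t<N. \<Sum>l\<in>UNIV. (cmod (fps_nth (y l) t))\<^sup>2)" by (rule sum.swap)
    finally show ?thesis .
  qed
  have "(\<Sum>t<N. \<Sum>k\<in>UNIV. (cmod (fps_nth (q k) t))\<^sup>2 * 1 ^ (2 * t)) \<le> (\<Sum>t<N. \<Sum>l\<in>UNIV. (cmod (fps_nth (y l) t))\<^sup>2)"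
  proof (rule LIMSEQ_le_const2)
    show "(\<lambda>n. \<Sum>t<N. \<Sum>k\<in>UNIV. (cmod (fps_nth (q k) t))\<^sup>2 * (of_nat n / of_nat (Suc n) :: real) ^ (2 * t))
      \<longlonglongrightarrow> (\<Sum>t<N. \<Sum>k\<in>UNIV. (cmod (fps_nth (q k) t))\<^sup>2 * 1 ^ (2 * t))"
      by (intro tendsto_sum tendsto_mult tendsto_const tendsto_power LIMSEQ_n_over_Suc_n)
    show "\<exists>M. \<forall>n\<ge>M. (\<Sum>t<N. \<Sum>k\<in>UNIV. (cmod (fps_nth (q k) t))\<^sup>2 * (of_nat n / of_nat (Suc n) :: real) ^ (2 * t))
      \<le> (\<Sum>t<N. \<Sum>l\<in>UNIV. (cmod (fps_nth (y l) t))\<^sup>2)"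
      by (intro exI allI impI le) auto
  qed
  then show ?thesis by (simp add: qy)
qed

section \<open>Passing between the half-plane and the disc\<close>

definition cayley_inv :: "complex \<Rightarrow> complex" where
  "cayley_inv z = \<i> * (1 + z) / (1 - z)"

lemma cayley_inv_upper_half:
  assumes "cmod z < 1"
  shows "cayley_inv z \<in> upper_half"
proof -
  have nz: "1 - z \<noteq> 0" using assms by auto
  have "cayley_inv z = \<i> * (1 + z) * cnj (1 - z) / of_real ((cmod (1 - z))\<^sup>2)"
    using nz by (simp add: cayley_inv_def complex_norm_square del: of_real_power)
  then have "Im (cayley_inv z) = Im (\<i> * (1 + z) * cnj (1 - z)) / (cmod (1 - z))\<^sup>2"
    by (metis Im_divide_of_real)
  also have "Im (\<i> * (1 + z) * cnj (1 - z)) = 1 - (cmod z)\<^sup>2"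
    unfolding cmod_power2 by (simp add: algebra_simps power2_eq_square)
  finally show ?thesis
    using assms nz by (simp add: upper_half_def abs_square_less_1 power_less_one_iff)
qed

lemma bfac_cayley_inv:
  assumes "z \<noteq> 1"
  shows "bfac (cayley_inv z) = z"
proof -
  have nz: "1 - z \<noteq> 0" using assms by auto
  have "cayley_inv z - \<i> = 2 * \<i> * z / (1 - z)" "cayley_inv z + \<i> = 2 * \<i> / (1 - z)"
    using nz by (simp_all add: cayley_inv_def field_simps)
  then show ?thesis using nz by (simp add: bfac_def)
qed

lemma holomorphic_cayley_inv: "cayley_inv holomorphic_on ball 0 1"
  unfolding cayley_inv_def by (intro holomorphic_intros) auto

lemma open_upper_half: "open upper_half"
  unfolding upper_half_def by (rule open_halfspace_Im_gt)

lemma connected_upper_half: "connected upper_half"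
  unfolding upper_half_def by (intro convex_connected convex_halfspace_Im_gt)

lemma holomorphic_on_compose_cayley_inv:
  assumes "f holomorphic_on upper_half"
  shows "(\<lambda>z. f (cayley_inv z)) holomorphic_on ball 0 1"
proof -
  have "cayley_inv ` ball 0 1 \<subseteq> upper_half" using cayley_inv_upper_half by auto
  from holomorphic_on_compose_gen[OF holomorphic_cayley_inv assms this] show ?thesis by (simp add: o_def)
qed

lemma (in cayley_pair) eval_transfer:
  fixes \<Theta> :: "complex \<Rightarrow> complex^'n^'n"
  assumes s: "\<And>z j k. z \<in> upper_half \<Longrightarrow> (\<lambda>t. bfac z ^ Suc t * hinner ((Vs ^^ t) (u j)) (v k)) sums \<Theta> z $ j $ k"
  shows "1 \<le> fps_conv_radius (transfer j k)"
    and "cmod z < 1 \<Longrightarrow> eval_fps (transfer j k) z = \<Theta> (cayley_inv z) $ j $ k"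
proof -
  have sums: "(\<lambda>t. fps_nth (transfer j k) t * z ^ t) sums \<Theta> (cayley_inv z) $ j $ k" if z: "cmod z < 1" for z
  proof -
    have "z \<noteq> 1" using z by auto
    then have "(\<lambda>t. fps_nth (transfer j k) (Suc t) * z ^ Suc t) sums \<Theta> (cayley_inv z) $ j $ k"
      using s[OF cayley_inv_upper_half[OF z], of j k] by (simp add: bfac_cayley_inv transfer_def mult_ac)
    \<comment> \<open>The vanishing coefficient at index 0 lets the sum start there instead of at
      1.\<close>
    then show ?thesis by (subst (asm) sums_Suc_iff) (simp add: transfer_def)
  qed
  show "1 \<le> fps_conv_radius (transfer j k)"
    by (rule one_le_fps_conv_radius_I) (rule sums_summable[OF sums])
  show "eval_fps (transfer j k) z = \<Theta> (cayley_inv z) $ j $ k" if "cmod z < 1"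
    using sums_unique[OF sums[OF that]] by (simp add: eval_fps_def)
qed

text \<open>The order gives the factorization only where det Theta is nonzero. A failure at one
  point would spread to an open set, on which det Theta would have to vanish, hence it would vanish
  identically.\<close>

lemma cf_le_factor:
  fixes \<Theta> \<Phi> :: "complex \<Rightarrow> complex^'n::finite^'n"
  assumes "cf_le \<Theta> \<Phi>"
  obtains G where "contractive_analytic G" "\<And>z. z \<in> upper_half \<Longrightarrow> \<Phi> z = \<Theta> z ** G z"
proof -
  obtain G z0 where cT: "contractive_analytic \<Theta>" and cP: "contractive_analytic \<Phi>" and cG: "contractive_analytic G"
    and z0: "z0 \<in> upper_half" "det (\<Theta> z0) \<noteq> 0"
    and G: "\<And>z. z \<in> upper_half \<Longrightarrow> det (\<Theta> z) \<noteq> 0 \<Longrightarrow> G z = matrix_inv (\<Theta> z) ** \<Phi> z"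
    using assms unfolding cf_le_def by blast
  have hol: "(\<lambda>z. \<Theta> z $ i $ j) holomorphic_on upper_half" "(\<lambda>z. \<Phi> z $ i $ j) holomorphic_on upper_half"
    "(\<lambda>z. G z $ i $ j) holomorphic_on upper_half" for i j
    using cT cP cG by (auto simp: contractive_analytic_def)
  have hdet: "(\<lambda>z. det (\<Theta> z)) holomorphic_on upper_half"
    unfolding det_def by (intro holomorphic_intros hol)
  have off: "\<Phi> z = \<Theta> z ** G z" if z: "z \<in> upper_half" "det (\<Theta> z) \<noteq> 0" for z
  proof -
    have "\<Theta> z ** matrix_inv (\<Theta> z) = mat 1"
      using z(2) unfolding invertible_det_nz[symmetric] invertible_def matrix_inv_def
      by (metis (mono_tags, lifting) someI_ex)
    then show ?thesis by (simp add: G[OF z] matrix_mul_assoc)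
  qed
  have "\<Phi> z $ j $ k = (\<Theta> z ** G z) $ j $ k" if z: "z \<in> upper_half" for z j k
  proof (rule ccontr)
    assume ne: "\<Phi> z $ j $ k \<noteq> (\<Theta> z ** G z) $ j $ k"
    define E where "E z = \<Phi> z $ j $ k - (\<Sum>l\<in>UNIV. \<Theta> z $ j $ l * G z $ l $ k)" for z
    have hE: "E holomorphic_on upper_half" unfolding E_def by (intro holomorphic_intros hol)
    define S where "S = {z \<in> upper_half. E z \<noteq> 0}"
    have opS: "open S"
      unfolding S_def using continuous_open_preimage[OF holomorphic_on_imp_continuous_on[OF hE] open_upper_half open_Compl[OF closed_singleton[of 0]]]
      by (simp add: vimage_def Int_def)
    have zS: "z \<in> S" using ne z by (simp add: S_def E_def matrix_matrix_mult_def)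
    have det0: "det (\<Theta> w) = 0" if "w \<in> S" for w
    proof (rule ccontr)
      assume "det (\<Theta> w) \<noteq> 0"
      then have "\<Phi> w = \<Theta> w ** G w" using off that by (simp add: S_def)
      then show False using that by (simp add: S_def E_def matrix_matrix_mult_def)
    qed
    have "S \<subseteq> upper_half" by (auto simp: S_def)
    from analytic_continuation_open[OF opS open_upper_half _ connected_upper_half this hdet holomorphic_on_const det0 z0(1)]
    have "det (\<Theta> z0) = 0" using zS by blast
    with z0 show False by simp
  qed
  then have "\<Phi> z = \<Theta> z ** G z" if "z \<in> upper_half" for z using that by (simp add: vec_eq_iff)
  with cG show thesis by (rule that)
qed

section \<open>Inner characteristic functions\<close>

text \<open>The radius of the disc ending at beta x, seen in the half-plane. Convergence to x and
  nontangential approach are both read off from this formula.\<close>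

lemma cayley_inv_beta_diff:
  assumes "0 \<le> r" "r < 1"
  shows "cayley_inv (of_real r * beta x) - of_real x
    = - of_real ((1 - r) * (1 + x\<^sup>2)) / (of_real ((1 - r) * x) + \<i> * of_real (1 + r))"
proof -
  let ?p = "complex_of_real x + \<i>" and ?d = "of_real ((1 - r) * x) + \<i> * of_real (1 + r)"
  have p: "?p \<noteq> 0" by (rule of_real_plus_ii_nz)
  have d: "?d \<noteq> 0" using assms by (simp add: complex_eq_iff)
  have "1 - of_real r * beta x = ?d / ?p" "1 + of_real r * beta x = (of_real ((1 + r) * x) + \<i> * of_real (1 - r)) / ?p"
    using p by (simp_all add: beta_def bfac_def field_simps)
  then have "cayley_inv (of_real r * beta x) = \<i> * (of_real ((1 + r) * x) + \<i> * of_real (1 - r)) / ?d"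
    using p by (simp add: cayley_inv_def)
  then have "cayley_inv (of_real r * beta x) - of_real x
      = (\<i> * (of_real ((1 + r) * x) + \<i> * of_real (1 - r)) - of_real x * ?d) / ?d"
    using d by (simp add: diff_divide_distrib)
  also have "\<i> * (of_real ((1 + r) * x) + \<i> * of_real (1 - r)) - of_real x * ?d = - of_real ((1 - r) * (1 + x\<^sup>2))"
    by (simp add: complex_eq_iff algebra_simps power2_eq_square)
  finally show ?thesis .
qed

text \<open>The ratio of |Re z - x| to Im z is |x| (1 - r) / (1 + r), so one angle contains the
  whole radius. Its aperture is |x| + 1 rather than |x| to be positive also at x = 0.\<close>

lemma cayley_inv_beta_stolz:
  assumes r: "0 \<le> r" "r < 1"
  shows "cayley_inv (of_real r * beta x) \<in> stolz x (\<bar>x\<bar> + 1)"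
proof -
  let ?z = "cayley_inv (of_real r * beta x)" and ?d = "of_real ((1 - r) * x) + \<i> * of_real (1 + r)"
  define \<kappa> where "\<kappa> = (1 - r) * (1 + x\<^sup>2) / (cmod ?d)\<^sup>2"
  have d: "?d \<noteq> 0" using r by (simp add: complex_eq_iff)
  have pos: "0 < \<kappa>" using r d one_plus_sq_pos[of x] by (simp add: \<kappa>_def)
  have "?z - of_real x = - of_real ((1 - r) * (1 + x\<^sup>2)) * cnj ?d / of_real ((cmod ?d)\<^sup>2)"
  proof -
    have "- A / w = - A * cnj w / of_real ((cmod w)\<^sup>2)" if "w \<noteq> 0" for A w
      using that by (simp add: complex_norm_square del: of_real_power)
    from this[OF d] show ?thesis unfolding cayley_inv_beta_diff[OF r] .
  qed
  also have "\<dots> = - of_real \<kappa> * cnj ?d" by (simp add: \<kappa>_def)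
  finally have e: "?z - of_real x = - of_real \<kappa> * cnj ?d" .
  have re: "Re ?z - x = - \<kappa> * ((1 - r) * x)" and im: "Im ?z = \<kappa> * (1 + r)"
    using arg_cong[OF e, of Re] arg_cong[OF e, of Im] by (simp_all add: algebra_simps)
  have "\<bar>Re ?z - x\<bar> = \<kappa> * ((1 - r) * \<bar>x\<bar>)"
    unfolding re using pos r by (simp add: abs_mult)
  also have "\<dots> \<le> \<kappa> * ((1 + r) * (\<bar>x\<bar> + 1))"
    using pos r by (intro mult_left_mono mult_mono) auto
  also have "\<dots> = (\<bar>x\<bar> + 1) * (\<kappa> * (1 + r))" by (simp add: mult_ac)
  finally have "\<bar>Re ?z - x\<bar> \<le> (\<bar>x\<bar> + 1) * (\<kappa> * (1 + r))" .
  moreover have "0 < \<kappa> * (1 + r)" using pos r by simp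
  ultimately show ?thesis unfolding stolz_def mem_Collect_eq im by blast
qed

lemma cayley_inv_beta_tendsto:
  assumes "r \<longlonglongrightarrow> 1" "\<And>n. 0 \<le> r n" "\<And>n. r n < 1"
  shows "(\<lambda>n. cayley_inv (of_real (r n) * beta x)) \<longlonglongrightarrow> of_real x"
proof -
  have "(\<lambda>n. - of_real ((1 - r n) * (1 + x\<^sup>2)) / (of_real ((1 - r n) * x) + \<i> * of_real (1 + r n)))
     \<longlonglongrightarrow> - of_real ((1 - 1) * (1 + x\<^sup>2)) / (of_real ((1 - 1) * x) + \<i> * complex_of_real (1 + 1))"
    by (intro tendsto_intros assms(1)) simp
  then have "(\<lambda>n. cayley_inv (of_real (r n) * beta x) - of_real x) \<longlonglongrightarrow> 0"
    by (simp add: cayley_inv_beta_diff[OF assms(2,3)])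
  then show ?thesis by (simp add: LIM_zero_iff)
qed

lemma unitary_mat_column:
  fixes U :: "complex^'n::finite^'n"
  assumes "unitary_mat U"
  shows "(\<Sum>j\<in>UNIV. (cmod (U $ j $ k))\<^sup>2) = 1"
proof -
  have "(cadj U ** U) $ k $ k = 1" using assms by (simp add: unitary_mat_def mat_def)
  then have "complex_of_real (\<Sum>j\<in>UNIV. (cmod (U $ j $ k))\<^sup>2) = 1"
    by (simp add: matrix_matrix_mult_def cadj_def complex_norm_square mult.commute del: of_real_power)
  then show ?thesis by (simp only: of_real_eq_1_iff)
qed

lemma contraction_column:
  fixes A :: "complex^'n::finite^'n"
  assumes "\<And>x. norm (A *v x) \<le> norm x"
  shows "(\<Sum>j\<in>UNIV. (cmod (A $ j $ k))\<^sup>2) \<le> 1"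
proof -
  have "norm (axis k (1::complex)) = 1"
    by (simp add: norm_vec_def L2_set_def axis_def if_distrib[of norm] if_distrib[of "\<lambda>x. x ^ 2"] cong: if_cong)
  moreover have "A *v axis k 1 = column k A"
    by (simp add: vec_eq_iff matrix_vector_mult_def column_def axis_def if_distrib cong: if_cong)
  ultimately have "norm (column k A) \<le> 1"
    using assms[of "axis k 1"] by simp
  then have "(norm (column k A))\<^sup>2 \<le> 1" by (simp add: abs_square_le_1)
  then show ?thesis by (simp add: norm_vec_def L2_set_def sum_nonneg column_def)
qed

text \<open>\<open>a t\<close> is the energy that V^t v_k loses at the next step, and also the
  squared norm of a Taylor coefficient of column k of Theta. That column has norm 1 almost
  everywhere on the boundary, so by Parseval the \<open>a t\<close> add up to 1, the whole energy of
  v_k.\<close>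

lemma (in cayley_pair) inner_imp_V_pow_v_tendsto_0:
  fixes \<Theta> :: "complex \<Rightarrow> complex^'n^'n"
  assumes s: "\<And>z j k. z \<in> upper_half \<Longrightarrow> (\<lambda>t. bfac z ^ Suc t * hinner ((Vs ^^ t) (u j)) (v k)) sums \<Theta> z $ j $ k"
    and inner: "inner_fn \<Theta>"
  shows "(\<lambda>m. (V ^^ m) (v k)) \<longlonglongrightarrow> 0"
proof -
  define a where "a t = (\<Sum>j\<in>UNIV. (cmod (hinner ((V ^^ t) (v k)) (u j)))\<^sup>2)" for t
  have a0: "0 \<le> a t" for t by (simp add: a_def sum_nonneg)
  have nv: "norm (v k) = 1" by (simp add: norm_eq_sqrt_hinner v_orthonormal)
  have en: "(norm ((V ^^ m) (v k)))\<^sup>2 = 1 - (\<Sum>t<m. a t)" for m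
    using V_pow_energy[of m "v k"] by (simp add: nv a_def)
  have "(\<Sum>t<m. a t) \<le> 1" for m using en[of m] zero_le_power2[of "norm ((V ^^ m) (v k))"] by linarith
  then have suma: "summable a" by (intro summableI_nonneg_bounded[of a 1] a0)
  have Re1: "1 \<le> fps_conv_radius (transfer j k)" for j by (rule eval_transfer(1)[OF s])
  have tr: "(cmod (fps_nth (transfer j k) (Suc t)))\<^sup>2 = (cmod (hinner ((V ^^ t) (v k)) (u j)))\<^sup>2" for j t
  proof -
    have "fps_nth (transfer j k) (Suc t) = cnj (hinner ((V ^^ t) (v k)) (u j))"
      by (simp add: transfer_def swap.adj_pow) (rule hinner_commute)
    then show ?thesis by simp
  qed
  have cont: "norm (\<Theta> z *v x) \<le> norm x" if "z \<in> upper_half" for z x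
    using inner that by (simp add: inner_fn_def contractive_analytic_def)
  have bdry: "AE x in lborel. \<exists>U. unitary_mat U \<and> (\<forall>c>0. (\<Theta> \<longlongrightarrow> U) (at (complex_of_real x) within stolz x c))"
    using inner by (simp add: inner_fn_def)
  define r where "r n = (of_nat n / of_nat (Suc n) :: real)" for n
  have r: "0 \<le> r n" "r n < 1" for n by (auto simp: r_def)
  have r1: "r \<longlonglongrightarrow> 1" unfolding r_def by (rule LIMSEQ_n_over_Suc_n)
  have rb: "cmod (of_real (r n) * beta x) < 1" for n x using r[of n] by (simp add: norm_mult norm_beta)
  define h where "h n x = (\<Sum>j\<in>UNIV. (cmod (eval_fps (transfer j k) (of_real (r n) * beta x)))\<^sup>2)" for n x
  have h: "h n x = (\<Sum>j\<in>UNIV. (cmod (\<Theta> (cayley_inv (of_real (r n) * beta x)) $ j $ k))\<^sup>2)" for n x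
    unfolding h_def by (simp add: eval_transfer(2)[OF s rb])
  have hint: "integrable cayley_measure (h n)" for n
    unfolding h_def by (intro Bochner_Integration.integrable_sum parseval_fps(2) Re1 r)
  \<comment> \<open>The weights r^(2t+2) are at most 1; the index shift uses that the transfer
    series has no constant term.\<close>
  have le: "(\<integral>x. h n x \<partial>cayley_measure) \<le> suminf a" for n
  proof -
    have "(\<lambda>t. \<Sum>j\<in>UNIV. (cmod (fps_nth (transfer j k) t))\<^sup>2 * r n ^ (2 * t)) sums (\<integral>x. h n x \<partial>cayley_measure)"
      unfolding h_def
      by (subst Bochner_Integration.integral_sum)
        (auto intro!: sums_sum parseval_fps Re1 r simp del: sum_distrib_right)
    then have "(\<lambda>t. \<Sum>j\<in>UNIV. (cmod (fps_nth (transfer j k) (Suc t)))\<^sup>2 * r n ^ (2 * Suc t)) sums (\<integral>x. h n x \<partial>cayley_measure)"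
      by (subst sums_Suc_iff) (simp add: transfer_def)
    then show ?thesis
    proof (rule sums_le[rotated, OF _ summable_sums[OF suma]])
      fix t
      have "r n ^ (2 * Suc t) \<le> 1" using r by (intro power_le_one) (auto simp: less_imp_le)
      then show "(\<Sum>j\<in>UNIV. (cmod (fps_nth (transfer j k) (Suc t)))\<^sup>2 * r n ^ (2 * Suc t)) \<le> a t"
        unfolding a_def tr by (intro sum_mono mult_left_le) auto
    qed
  qed
  \<comment> \<open>\<open>h n x\<close> is the squared norm of a column of a contraction, hence at
    most 1, and along the radius it tends almost everywhere to that of a unitary column.\<close>
  have "(\<lambda>n. \<integral>x. h n x \<partial>cayley_measure) \<longlonglongrightarrow> (\<integral>x. 1 \<partial>cayley_measure)"
  proof (rule integral_dominated_convergence[where w = "\<lambda>_. 1"])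
    show "AE x in cayley_measure. (\<lambda>n. h n x) \<longlonglongrightarrow> 1"
      unfolding cayley_measure_def
    proof (subst AE_density)
      show "AE x in lborel. 0 < ennreal (1 / (pi * (1 + x\<^sup>2))) \<longrightarrow> (\<lambda>n. h n x) \<longlonglongrightarrow> 1"
        using bdry
      proof eventually_elim
        case (elim x)
        then obtain U where U: "unitary_mat U"
          "\<And>c. c > 0 \<Longrightarrow> (\<Theta> \<longlongrightarrow> U) (at (complex_of_real x) within stolz x c)" by blast
        have "filterlim (\<lambda>n. cayley_inv (of_real (r n) * beta x)) (at (complex_of_real x) within stolz x (\<bar>x\<bar> + 1)) sequentially"
          unfolding filterlim_at
        proof (intro conjI always_eventually allI cayley_inv_beta_tendsto r1 r cayley_inv_beta_stolz)
          fix n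
          have "Im (cayley_inv (of_real (r n) * beta x)) > 0"
            using cayley_inv_beta_stolz[OF r[of n], of x] by (simp add: stolz_def)
          then show "cayley_inv (of_real (r n) * beta x) \<noteq> of_real x" by auto
        qed
        then have "(\<lambda>n. \<Theta> (cayley_inv (of_real (r n) * beta x))) \<longlonglongrightarrow> U"
          by (rule filterlim_compose[rotated]) (rule U(2), simp)
        then have "(\<lambda>n. h n x) \<longlonglongrightarrow> (\<Sum>j\<in>UNIV. (cmod (U $ j $ k))\<^sup>2)"
          unfolding h by (intro tendsto_intros)
        then show ?case by (simp add: unitary_mat_column[OF U(1)])
      qed
    qed measurable
    show "h n \<in> borel_measurable cayley_measure" for n using hint by (rule borel_measurable_integrable)
    show "AE x in cayley_measure. norm (h n x) \<le> 1" for n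
    proof (rule AE_I2)
      fix x
      have "h n x \<le> 1" unfolding h by (intro contraction_column cont cayley_inv_upper_half rb)
      moreover have "0 \<le> h n x" unfolding h by (intro sum_nonneg) simp
      ultimately show "norm (h n x) \<le> 1" by simp
    qed
  qed auto
  moreover have "(\<integral>x. 1 \<partial>cayley_measure) = (1::real)" using prob_cayley_measure by (simp add: measure_def)
  ultimately have "(\<lambda>n. \<integral>x. h n x \<partial>cayley_measure) \<longlonglongrightarrow> 1" by simp
  then have S: "1 \<le> suminf a" by (rule LIMSEQ_le_const2) (use le in blast)
  have "(\<lambda>m. 1 - (\<Sum>t<m. a t)) \<longlonglongrightarrow> 1 - suminf a"
    by (intro tendsto_intros summable_LIMSEQ suma)
  then have lim: "(\<lambda>m. (norm ((V ^^ m) (v k)))\<^sup>2) \<longlonglongrightarrow> 1 - suminf a" by (simp add: en)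
  moreover have "0 \<le> 1 - suminf a" using lim by (rule LIMSEQ_le_const) auto
  ultimately have "(\<lambda>m. (norm ((V ^^ m) (v k)))\<^sup>2) \<longlonglongrightarrow> 0" using S by simp
  then have "(\<lambda>m. sqrt ((norm ((V ^^ m) (v k)))\<^sup>2)) \<longlonglongrightarrow> sqrt 0" by (rule tendsto_real_sqrt)
  then show ?thesis by (simp add: tendsto_norm_zero_iff)
qed

theorem mainTheorem6:
  fixes n :: nat
    and D1 :: "'a::chilbert set" and T1 :: "'a \<Rightarrow> 'a"
    and D2 :: "'b::chilbert set" and T2 :: "'b \<Rightarrow> 'b"
    and \<Theta>1 \<Theta>2 :: "complex \<Rightarrow> complex^'n::finite^'n"
  assumes "CARD('n) = n"
    and "separable_hilbert TYPE('a)" and "separable_hilbert TYPE('b)"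
    and "in_S n D1 T1" and "in_S n D2 T2"
    and "livsic_cf D1 T1 \<Theta>1" and "livsic_cf D2 T2 \<Theta>2"
    and "inner_fn \<Theta>1" and "cf_le \<Theta>1 \<Theta>2"
  shows "op_le D1 T1 D2 T2"
proof -
  have B1: "lin_transf D1 T1" "symmetric_op D1 T1" "closed_op D1 T1" and simple1: "simple_op D1 T1"
    and B2: "lin_transf D2 T2" "symmetric_op D2 T2" "closed_op D2 T2"
    using assms(4,5) by (simp_all add: in_S_def)
  obtain V1 Vs1 and u1 v1 :: "'n \<Rightarrow> 'a" where cp1: "cayley_pair V1 Vs1 u1 v1"
    and link1: "\<And>f. f \<in> D1 \<Longrightarrow> V1 (T1 f + hscale \<i> f) = T1 f - hscale \<i> f"
    and ran1: "\<And>g. (\<And>j. hinner g (u1 j) = 0) \<Longrightarrow> \<exists>f\<in>D1. g = T1 f + hscale \<i> f"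
    and ort1: "\<And>f j. f \<in> D1 \<Longrightarrow> hinner (T1 f + hscale \<i> f) (u1 j) = 0"
    and s1: "\<And>z j k. z \<in> upper_half \<Longrightarrow> (\<lambda>t. bfac z ^ Suc t * hinner ((Vs1 ^^ t) (u1 j)) (v1 k)) sums \<Theta>1 z $ j $ k"
    by (rule livsic_cf_coeffs[OF B1 assms(6)]) blast
  obtain V2 Vs2 and u2 v2 :: "'n \<Rightarrow> 'b" where cp2: "cayley_pair V2 Vs2 u2 v2"
    and link2: "\<And>f. f \<in> D2 \<Longrightarrow> V2 (T2 f + hscale \<i> f) = T2 f - hscale \<i> f"
    and ran2: "\<And>g. (\<And>j. hinner g (u2 j) = 0) \<Longrightarrow> \<exists>f\<in>D2. g = T2 f + hscale \<i> f"
    and ort2: "\<And>f j. f \<in> D2 \<Longrightarrow> hinner (T2 f + hscale \<i> f) (u2 j) = 0"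
    and s2: "\<And>z j k. z \<in> upper_half \<Longrightarrow> (\<lambda>t. bfac z ^ Suc t * hinner ((Vs2 ^^ t) (u2 j)) (v2 k)) sums \<Theta>2 z $ j $ k"
    by (rule livsic_cf_coeffs[OF B2 assms(7)]) blast
  interpret c1: cayley_pair V1 Vs1 u1 v1 by (rule cp1)
  interpret c2: cayley_pair V2 Vs2 u2 v2 by (rule cp2)
  obtain G where G: "contractive_analytic G" and fac: "\<And>z. z \<in> upper_half \<Longrightarrow> \<Theta>2 z = \<Theta>1 z ** G z"
    using cf_le_factor[OF assms(9)] by blast
  \<comment> \<open>Taylor series of \<open>G\<close> in the disc variable.\<close>
  define g where "g l k = fps_expansion (\<lambda>z. G (cayley_inv z) $ l $ k) 0" for l k
  have hol: "(\<lambda>z. G (cayley_inv z) $ l $ k) holomorphic_on eball 0 1" for l k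
  proof -
    have "(\<lambda>z. G z $ l $ k) holomorphic_on upper_half" using G by (simp add: contractive_analytic_def)
    from holomorphic_on_compose_cayley_inv[OF this] show ?thesis by (simp add: one_ereal_def)
  qed
  have R: "1 \<le> fps_conv_radius (g l k)" for l k
    unfolding g_def by (rule conv_radius_fps_expansion[OF hol])
  have eval_g: "eval_fps (g l k) z = G (cayley_inv z) $ l $ k" if "cmod z < 1" for l k z
    unfolding g_def using eval_fps_expansion'[OF hol, of z] that by (simp add: one_ereal_def)
  show ?thesis
  proof (rule op_le_if_transfer_factors[OF cp1 cp2 link1 link2 ran2 ort1])
    show "(\<lambda>m. (V1 ^^ m) h) \<longlonglongrightarrow> 0" for h
      by (rule c1.V_pow_tendsto_0[OF link1 ran1 simple1 c1.inner_imp_V_pow_v_tendsto_0[OF s1 assms(8)]])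
    \<comment> \<open>The factorization of functions becomes one of formal power series, since equal
      sums near 0 force equal coefficients.\<close>
    show "c2.transfer j k = (\<Sum>l\<in>UNIV. c1.transfer j l * g l k)" for j k
    proof (rule eval_fps_eqD)
      have R1: "1 \<le> fps_conv_radius (c1.transfer j l)" for l by (rule c1.eval_transfer(1)[OF s1])
      have "1 \<le> fps_conv_radius (c2.transfer j k)" by (rule c2.eval_transfer(1)[OF s2])
      then show "0 < fps_conv_radius (c2.transfer j k)" by (rule less_le_trans[rotated]) simp
      show "0 < fps_conv_radius (\<Sum>l\<in>UNIV. c1.transfer j l * g l k)"
        by (rule less_le_trans[OF _ eval_fps_sum_mult(1)[OF R1 R]]) simp
      have "eval_fps (c2.transfer j k) z = eval_fps (\<Sum>l\<in>UNIV. c1.transfer j l * g l k) z" if z: "cmod z < 1" for z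
      proof -
        have "eval_fps (c2.transfer j k) z = \<Theta>2 (cayley_inv z) $ j $ k"
          by (rule c2.eval_transfer(2)[OF s2 z])
        moreover have "eval_fps (c1.transfer j l) z = \<Theta>1 (cayley_inv z) $ j $ l" for l
          by (rule c1.eval_transfer(2)[OF s1 z])
        ultimately show ?thesis
          unfolding eval_fps_sum_mult(2)[OF R1 R z]
          by (simp add: fac[OF cayley_inv_upper_half[OF z]] matrix_matrix_mult_def eval_g[OF z])
      qed
      moreover have "eventually (\<lambda>z. z \<in> ball (0::complex) 1) (nhds 0)" by (intro eventually_nhds_in_open) auto
      ultimately show "\<forall>\<^sub>F z in nhds 0. eval_fps (c2.transfer j k) z = eval_fps (\<Sum>l\<in>UNIV. c1.transfer j l * g l k) z"
        by (auto elim!: eventually_mono)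
    qed
    show "(\<Sum>t<N. \<Sum>k\<in>UNIV. (cmod (fps_nth (\<Sum>l\<in>UNIV. y l * g l k) t))\<^sup>2) \<le> (\<Sum>t<N. \<Sum>l\<in>UNIV. (cmod (fps_nth (y l) t))\<^sup>2)" for y N
    proof (rule toeplitz_contraction[OF R])
      fix z x assume z: "cmod z < 1"
      have "(\<chi> l k. eval_fps (g l k) z) = G (cayley_inv z)" by (simp add: vec_eq_iff eval_g[OF z])
      then show "norm ((\<chi> l k. eval_fps (g l k) z) *v x) \<le> norm x"
        using G cayley_inv_upper_half[OF z] by (simp add: contractive_analytic_def)
    qed
  qed
qed

end
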